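(* Let $p \in (1/2, 1]$ be fixed (independently of $n$) and let $Q \sim Q_2(n,p)$. Then with high probability $\pi_1(Q) = 0$, i.e. $\lim_{n\to\infty} \mathbb{P}[\pi_1(Q) \text{ is trivial}] = 1$.
   Context: $Q^n=[0,1]^n$ is the $n$-dimensional cube with its standard cubical (face) structure; its vertices are $\{0,1\}^n$, its $1$-faces (edges) join vertices differing in exactly one coordinate, and $Q^n_k$ denotes its $k$-skeleton. The random $2$-dimensional cubical complex $Q_2(n,p)$ has $1$-skeleton equal to $Q^n_1$, and each $2$-dimensional face of $Q^n$ is included independently with probability $p$. "With high probability" means with probability tending to $1$ as $n \to \infty$. *)

theory Defs
  imports "HOL-Analysis.Analysis" "HOL-Probability.Probability" "HOL-Algebra.Elementary_Groups"
begin

text \<open>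
  The cube \<open>[0,1]^n\<close> is realised for all \<open>n\<close> inside the single type \<^typ>\<open>nat \<Rightarrow> real\<close>, with the
  coordinates of index \<open>\<ge> n\<close> set to \<open>0\<close>. The topology of \<^typ>\<open>nat \<Rightarrow> real\<close> is the product
  topology, so on these sets it induces the Euclidean topology of \<open>R^n\<close> (compare
  \<^const>\<open>Euclidean_space\<close>).
\<close>

definition cube :: "nat \<Rightarrow> (nat \<Rightarrow> real) set" where
  "cube n = {x. (\<forall>i<n. 0 \<le> x i \<and> x i \<le> 1) \<and> (\<forall>i\<ge>n. x i = 0)}"

definition cube_vertices :: "nat \<Rightarrow> (nat \<Rightarrow> real) set" where
  "cube_vertices n = {v. (\<forall>i<n. v i = 0 \<or> v i = 1) \<and> (\<forall>i\<ge>n. v i = 0)}"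

text \<open>
  \<open>F\<close> is the set of free coordinates. Distinct vertices \<open>v\<close> that agree outside \<open>F\<close> give the same
  face; faces are therefore treated as point sets, so that each is counted once.
\<close>

definition cube_face :: "nat \<Rightarrow> nat set \<Rightarrow> (nat \<Rightarrow> real) \<Rightarrow> (nat \<Rightarrow> real) set" where
  "cube_face n F v = {x \<in> cube n. \<forall>i<n. i \<notin> F \<longrightarrow> x i = v i}"

definition cube_faces :: "nat \<Rightarrow> nat \<Rightarrow> (nat \<Rightarrow> real) set set" where
  "cube_faces n k = {cube_face n F v | F v. F \<subseteq> {..<n} \<and> card F = k \<and> v \<in> cube_vertices n}"

lemma finite_cube_vertices: "finite (cube_vertices n)"
proof -
  have "cube_vertices n \<subseteq> (\<lambda>S i. if i \<in> S then 1 else 0) ` Pow {..<n}"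
  proof
    fix v assume v: "v \<in> cube_vertices n"
    have "v i = (if i \<in> {i. i < n \<and> v i = 1} then 1 else 0)" for i
      using v by (cases "i < n") (auto simp: cube_vertices_def)
    then show "v \<in> (\<lambda>S i. if i \<in> S then 1 else 0) ` Pow {..<n}"
      by (intro image_eqI[where x = "{i. i < n \<and> v i = 1}"]) auto
  qed
  then show ?thesis
    by (rule finite_subset) simp
qed

text \<open>Finiteness matters here because \<^const>\<open>Pi_pmf\<close> is meaningful only over a finite index set.\<close>

lemma finite_cube_faces: "finite (cube_faces n k)"
proof -
  have "cube_faces n k \<subseteq> (\<lambda>(F, v). cube_face n F v) ` (Pow {..<n} \<times> cube_vertices n)"
    by (auto simp: cube_faces_def)
  then show ?thesis
    by (rule finite_subset) (simp add: finite_cube_vertices)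
qed

text \<open>
  The random complex is the random set of its closed cells; the underlying space of a complex \<open>K\<close>
  is the union \<open>\<Union>K\<close>.
\<close>

definition random_cubical_2_complex :: "nat \<Rightarrow> real \<Rightarrow> (nat \<Rightarrow> real) set set pmf" where
  "random_cubical_2_complex n p =
     map_pmf (\<lambda>\<omega>. cube_faces n 0 \<union> cube_faces n 1 \<union> {\<sigma> \<in> cube_faces n 2. \<omega> \<sigma>})
       (Pi_pmf (cube_faces n 2) False (\<lambda>_. bernoulli_pmf p))"

text \<open>
  A function \<^typ>\<open>real \<Rightarrow> 'a\<close> represents a path through its restriction to \<open>[0,1]\<close>;
  \<^const>\<open>homotopic_paths\<close> (homotopy in \<open>S\<close> relative to the end points) ignores all other values,
  and \<^prop>\<open>homotopic_paths S f g\<close> implies that \<open>f\<close> and \<open>g\<close> are paths in \<open>S\<close>.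
\<close>

definition loop_class :: "'a::topological_space set \<Rightarrow> (real \<Rightarrow> 'a) \<Rightarrow> (real \<Rightarrow> 'a) set" where
  "loop_class S f = {g. homotopic_paths S f g}"

definition fundamental_group :: "'a::topological_space set \<Rightarrow> 'a \<Rightarrow> (real \<Rightarrow> 'a) set monoid" where
  "fundamental_group S x =
     \<lparr>carrier = {loop_class S f | f.
         path f \<and> path_image f \<subseteq> S \<and> pathstart f = x \<and> pathfinish f = x},
      mult = (\<lambda>A B. \<Union>f\<in>A. \<Union>g\<in>B. loop_class S (f +++ g)),
      one = loop_class S (\<lambda>_. x)\<rparr>"

lemma loop_class_eq: "homotopic_paths S f g \<Longrightarrow> loop_class S f = loop_class S g"
  unfolding loop_class_def
  by (auto intro: homotopic_paths_trans homotopic_paths_sym)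

lemma fundamental_group_mult:
  assumes "path f" "path_image f \<subseteq> S" "pathstart f = x" "pathfinish f = x"
    and "path g" "path_image g \<subseteq> S" "pathstart g = x" "pathfinish g = x"
  shows "loop_class S f \<otimes>\<^bsub>fundamental_group S x\<^esub> loop_class S g = loop_class S (f +++ g)"
proof -
  have eq: "loop_class S (f' +++ g') = loop_class S (f +++ g)"
    if "f' \<in> loop_class S f" "g' \<in> loop_class S g" for f' g'
  proof (rule loop_class_eq)
    from that have "homotopic_paths S f f'" "homotopic_paths S g g'"
      by (auto simp: loop_class_def)
    then have "homotopic_paths S (f +++ g) (f' +++ g')"
      using assms by (intro homotopic_paths_join) auto
    then show "homotopic_paths S (f' +++ g') (f +++ g)"
      by (rule homotopic_paths_sym)
  qed
  have "f \<in> loop_class S f" "g \<in> loop_class S g"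
    using assms by (auto simp: loop_class_def)
  then have "(\<Union>f'\<in>loop_class S f. \<Union>g'\<in>loop_class S g. loop_class S (f' +++ g')) = loop_class S (f +++ g)"
    using eq by blast
  then show ?thesis
    by (simp add: fundamental_group_def)
qed

end

theory Submission
  imports Defs "HOL-Real_Asymp.Real_Asymp"
begin

text \<open>
  Topology. Let \<open>K\<close> be a subcomplex of the cube that contains all edges, and suppose that the
  boundary of every square of the cube is null-homotopic in \<open>\<Union>K\<close>. Then \<open>\<Union>K\<close> is simply connected
  (\<open>trivial_fundamental_group\<close>). Each vertex is joined to the origin by the canonical edge path that
  adjusts the coordinates in order. Since flips of coordinates may be interchanged across squares,
  following an edge after a canonical path gives another canonical path (\<open>staircase_flip\<close>). Open
  stars of vertices are starlike, so the same follows for arbitrary paths after subdivision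
  (\<open>to_point_transport\<close>), and a loop at \<open>x\<close> satisfies \<open>c g \<sim> c\<close> for the canonical path \<open>c\<close> to \<open>x\<close>.

  Contracting squares. If five faces of a 3-cube have null-homotopic boundary, so has the sixth
  (\<open>commuting_cube\<close>). A square with directions \<open>i\<close>, \<open>j\<close> therefore contracts as soon as, for some
  direction \<open>k\<close>, the parallel square in direction \<open>k\<close> is present and the four side squares contract.
  Asking for present side squares would be too much: all directions would fail with
  probability \<open>(1 - p^5)^(n - 2)\<close>, far more than \<open>2^(-n)\<close> when \<open>p\<close> is near \<open>1/2\<close>, whereas there are
  about \<open>n^2 2^n\<close> squares. Instead, a side square over the edge \<open>e\<close> is contracted through a second
  3-cube, with an auxiliary direction \<open>l\<close> for which the square spanned by \<open>e\<close> and \<open>l\<close> is present;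
  the four other faces of that 3-cube are then required to be present.

  Probability. Fix \<open>m\<close> so large that \<open>q = (1 - p) + 4 (1 - p^4)^m < 1/2\<close>. There are at most \<open>n 2^n\<close>
  edges, and a given edge lies in at most \<open>m\<close> present squares with probability at most
  \<open>n^m (1 - p)^(n - m - 1)\<close>; as \<open>1 - p < 1/2\<close>, with high probability this happens for no edge
  (\<open>prob_bad_edge\<close>). So each edge of each square has \<open>m\<close> auxiliary directions. Once these are fixed,
  a direction \<open>k\<close> fails with probability at most \<open>q\<close>: either the parallel square is missing, or all
  \<open>m\<close> auxiliary directions fail at one of the four edges. Different \<open>k\<close> use different squares, so
  the failures are independent, and all of them occur with probability at most \<open>q^(n - 4 m - 2)\<close>
  (\<open>prob_uncapped\<close>). Multiplied by the number of squares and by the at most \<open>n^(4 m)\<close> choices of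
  auxiliary directions, this still tends to zero (\<open>prob_bad_square\<close>), because \<open>q < 1/2\<close>.
\<close>

section \<open>Paths up to homotopy\<close>

text \<open>
  The interval is convex, so two paths in it with common end points are homotopic, and a path \<open>p\<close>
  carries that homotopy to its own image. Each groupoid law of paths below is an instance, with
  \<open>f\<close> and \<open>g\<close> piecewise linear. This argument puts no linear structure on the target space, which
  is what allows its use for the product space \<^typ>\<open>nat \<Rightarrow> real\<close>.
\<close>

lemma homotopic_paths_reparam_image:
  fixes p :: "real \<Rightarrow> 'a::topological_space"
  assumes "path p" "path_image p \<subseteq> S"
    and "path f" "path_image f \<subseteq> {0..1}" "path g" "path_image g \<subseteq> {0..1}"
    and "pathstart f = pathstart g" "pathfinish f = pathfinish g"
  shows "homotopic_paths S (p \<circ> f) (p \<circ> g)"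
proof (rule homotopic_paths_continuous_image)
  show "homotopic_paths {0..1} f g"
  proof (rule homotopic_paths_linear)
    fix t :: real assume "t \<in> {0..1}"
    then have "f t \<in> {0..1}" "g t \<in> {0..1}"
      using assms(4,6) unfolding path_image_def by blast+
    then show "closed_segment (f t) (g t) \<subseteq> {0..1}"
      by (intro closed_segment_subset) auto
  qed (use assms in \<open>auto simp: pathstart_def pathfinish_def\<close>)
  show "continuous_on {0..1} p" using assms by (simp add: path_def)
  show "p \<in> {0..1} \<rightarrow> S" using assms by (auto simp: path_image_def)
qed

lemma path_const [simp]: "path (\<lambda>_. x)"
  by (simp add: path_def)

lemma homotopic_paths_join_const:
  fixes p :: "real \<Rightarrow> 'a::topological_space"
  assumes "path p" "path_image p \<subseteq> S" "p 1 = x"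
  shows "homotopic_paths S (p +++ (\<lambda>_. x)) p"
proof -
  have "homotopic_paths S (p \<circ> (linepath 0 1 +++ linepath 1 1)) (p \<circ> linepath 0 1)"
    by (rule homotopic_paths_reparam_image)
      (use assms in \<open>auto simp: path_image_join closed_segment_eq_real_ivl\<close>)
  moreover have "p \<circ> (linepath 0 1 +++ linepath 1 1) = p +++ (\<lambda>_. x)" "p \<circ> linepath 0 1 = p"
    using assms by (auto simp: joinpaths_def linepath_def fun_eq_iff)
  ultimately show ?thesis by simp
qed

lemma homotopic_paths_const_join:
  fixes p :: "real \<Rightarrow> 'a::topological_space"
  assumes "path p" "path_image p \<subseteq> S" "p 0 = x"
  shows "homotopic_paths S ((\<lambda>_. x) +++ p) p"
proof -
  have "homotopic_paths S (p \<circ> (linepath 0 0 +++ linepath 0 1)) (p \<circ> linepath 0 1)"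
    by (rule homotopic_paths_reparam_image)
      (use assms in \<open>auto simp: path_image_join closed_segment_eq_real_ivl\<close>)
  moreover have "p \<circ> (linepath 0 0 +++ linepath 0 1) = (\<lambda>_. x) +++ p" "p \<circ> linepath 0 1 = p"
    using assms by (auto simp: joinpaths_def linepath_def fun_eq_iff)
  ultimately show ?thesis by simp
qed

lemma homotopic_paths_join_reversepath:
  fixes p :: "real \<Rightarrow> 'a::topological_space"
  assumes "path p" "path_image p \<subseteq> S" "p 0 = x"
  shows "homotopic_paths S (p +++ reversepath p) (\<lambda>_. x)"
proof -
  have "homotopic_paths S (p \<circ> (linepath 0 1 +++ linepath 1 0)) (p \<circ> linepath 0 0)"
    by (rule homotopic_paths_reparam_image)
      (use assms in \<open>auto simp: path_image_join closed_segment_eq_real_ivl\<close>)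
  moreover have "p \<circ> (linepath 0 1 +++ linepath 1 0) = p +++ reversepath p" "p \<circ> linepath 0 0 = (\<lambda>_. x)"
    using assms by (auto simp: joinpaths_def linepath_def reversepath_def fun_eq_iff)
  ultimately show ?thesis by simp
qed

lemma homotopic_paths_join_pieces:
  fixes g :: "real \<Rightarrow> 'a::topological_space"
  assumes "path g" "path_image g \<subseteq> S" "u \<in> {0..1}" "v \<in> {0..1}" "w \<in> {0..1}"
  shows "homotopic_paths S ((g \<circ> linepath u v) +++ (g \<circ> linepath v w)) (g \<circ> linepath u w)"
proof -
  have sub: "closed_segment a b \<subseteq> {0..1}" if "a \<in> {0..1}" "b \<in> {0..1}" for a b :: real
    using that by (intro closed_segment_subset) auto
  have "homotopic_paths S (g \<circ> (linepath u v +++ linepath v w)) (g \<circ> linepath u w)"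
    by (rule homotopic_paths_reparam_image) (use assms sub in \<open>simp_all add: path_image_join\<close>)
  then show ?thesis by (simp only: path_compose_join)
qed

lemma homotopic_paths_ends:
  assumes "homotopic_paths S p q"
  shows "path p" "path q" "path_image p \<subseteq> S" "path_image q \<subseteq> S" "p 0 = q 0" "p 1 = q 1"
  using homotopic_paths_imp_path[OF assms] homotopic_paths_imp_subset[OF assms]
    homotopic_paths_imp_pathstart[OF assms] homotopic_paths_imp_pathfinish[OF assms]
  by (auto simp: pathstart_def pathfinish_def)

lemma joinpaths_0 [simp]: "(p +++ q) 0 = p 0" and joinpaths_1 [simp]: "(p +++ q) 1 = q 1"
  by (auto simp: joinpaths_def)

lemma reversepath_0: "reversepath p 0 = p 1" and reversepath_1: "reversepath p 1 = p 0"
  by (auto simp: reversepath_def)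

text \<open>
  Prefixing both sides with the reverse of \<open>k\<close> turns \<open>k\<close> into a constant path.
\<close>

lemma homotopic_paths_cancel_left:
  fixes p q k :: "real \<Rightarrow> 'a::topological_space"
  assumes k: "path k" "path_image k \<subseteq> S" "k 1 = q 0" "k 1 = p 0"
    and p: "path p" "path_image p \<subseteq> S"
    and q: "path q" "path_image q \<subseteq> S"
    and h: "homotopic_paths S (k +++ p) (k +++ q)"
  shows "homotopic_paths S p q"
proof -
  let ?r = "reversepath k"
  have *: "homotopic_paths S u (?r +++ (k +++ u))"
    if "path u" "path_image u \<subseteq> S" "u 0 = k 1" for u
  proof -
    have "homotopic_paths S u ((\<lambda>_. k 1) +++ u)"
      using homotopic_paths_const_join[of u S "k 1"] that homotopic_paths_sym by blast
    also have "homotopic_paths S \<dots> ((?r +++ reversepath ?r) +++ u)"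
      by (intro homotopic_paths_join)
        (use k that homotopic_paths_join_reversepath[of ?r S "k 1"] in
          \<open>auto simp: homotopic_paths_sym_eq pathstart_def pathfinish_def reversepath_0 reversepath_1\<close>)
    also have "homotopic_paths S \<dots> (?r +++ (k +++ u))"
      using homotopic_paths_assoc[of ?r S k u] k that
      by (auto simp: homotopic_paths_sym_eq pathstart_def pathfinish_def reversepath_0 reversepath_1)
    finally show ?thesis .
  qed
  have "homotopic_paths S p (?r +++ (k +++ p))" using * p k by auto
  also have "homotopic_paths S \<dots> (?r +++ (k +++ q))"
    by (rule homotopic_paths_join[OF _ h]) (use k in \<open>auto simp: pathfinish_def pathstart_def reversepath_1\<close>)
  also have "homotopic_paths S \<dots> q" by (rule homotopic_paths_sym, rule *) (use q k in auto)
  finally show ?thesis .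
qed

lemma homotopic_paths_cancel_right:
  fixes p q k :: "real \<Rightarrow> 'a::topological_space"
  assumes k: "path k" "path_image k \<subseteq> S" "k 0 = q 1" "k 0 = p 1"
    and p: "path p" "path_image p \<subseteq> S"
    and q: "path q" "path_image q \<subseteq> S"
    and h: "homotopic_paths S (p +++ k) (q +++ k)"
  shows "homotopic_paths S p q"
proof -
  have "homotopic_paths S (reversepath k +++ reversepath p) (reversepath k +++ reversepath q)"
    using h k reversepath_joinpaths[of p k] reversepath_joinpaths[of q k]
    by (metis homotopic_paths_reversepath pathfinish_def pathstart_def)
  then have "homotopic_paths S (reversepath p) (reversepath q)"
    by (rule homotopic_paths_cancel_left[rotated -1]) (use k p q in \<open>auto simp: reversepath_0 reversepath_1\<close>)
  then show ?thesis by (simp add: homotopic_paths_reversepath)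
qed

lemma homotopic_paths_assoc_right:
  fixes p q r :: "real \<Rightarrow> 'a::topological_space"
  assumes "path p" "path_image p \<subseteq> S" "path q" "path_image q \<subseteq> S" "path r" "path_image r \<subseteq> S"
    "p 1 = q 0" "q 1 = r 0"
  shows "homotopic_paths S ((p +++ q) +++ r) (p +++ (q +++ r))"
  using homotopic_paths_assoc[of p S q r] assms
  by (auto simp: homotopic_paths_sym_eq pathstart_def pathfinish_def)

lemma homotopic_paths_join':
  assumes "homotopic_paths S p p'" "homotopic_paths S q q'" "p 1 = q 0"
  shows "homotopic_paths S (p +++ q) (p' +++ q')"
  using assms by (intro homotopic_paths_join) (auto simp: pathstart_def pathfinish_def)

section \<open>Straight segments in products of lines\<close>

text \<open>
  The type \<^typ>\<open>nat \<Rightarrow> real\<close> of the cube is not a normed vector space, so straight segments are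
  built coordinate by coordinate instead of with \<^const>\<open>linepath\<close>.
\<close>

definition seg :: "('i \<Rightarrow> real) \<Rightarrow> ('i \<Rightarrow> real) \<Rightarrow> real \<Rightarrow> 'i \<Rightarrow> real" where
  "seg x y t i = (1 - t) * x i + t * y i"

lemma seg_ends [simp]: "seg x y 0 = x" "seg x y 1 = y"
  by (auto simp: seg_def)

lemma seg_refl: "seg x x = (\<lambda>_. x)"
  by (auto simp: seg_def fun_eq_iff algebra_simps)

lemma path_seg [simp]: "path (seg x y)"
  unfolding path_def seg_def[abs_def]
  by (intro continuous_on_coordinatewise_then_product continuous_intros)

lemma path_image_segI: "(\<And>t. 0 \<le> t \<Longrightarrow> t \<le> 1 \<Longrightarrow> seg x y t \<in> S) \<Longrightarrow> path_image (seg x y) \<subseteq> S"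
  by (auto simp: path_image_def)

text \<open>
  Coning off \<open>g\<close> from \<open>v\<close> is a map of the unit square whose four sides are \<open>seg v (g 0)\<close>, \<open>g\<close>, the
  constant path at \<open>v\<close> and \<open>seg v (g 1)\<close>. The two ways around the square are homotopic because
  the square is convex.
\<close>

lemma homotopic_paths_starlike:
  fixes g :: "real \<Rightarrow> 'i \<Rightarrow> real"
  assumes star: "\<And>x. x \<in> S \<Longrightarrow> path_image (seg v x) \<subseteq> S"
    and g: "path g" "path_image g \<subseteq> S"
  shows "homotopic_paths S (seg v (g 0) +++ g) (seg v (g 1))"
proof -
  define h where "h = (\<lambda>z::real \<times> real. seg v (g (snd z)) (fst z))"
  have gS: "g t \<in> S" if "t \<in> {0..1}" for t
    using g that by (auto simp: path_image_def)
  have vS: "v \<in> S"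
    using star[OF gS[of 0]] by (auto simp: path_image_def image_subset_iff dest!: bspec[where x = 0])
  have hS: "h \<in> ({0..1} \<times> {0..1}) \<rightarrow> S"
    using star gS by (force simp: h_def path_image_def)
  have gi: "continuous_on {0..1} (\<lambda>t. g t i)" for i
    using g by (auto simp: path_def intro: continuous_on_product_then_coordinatewise)
  have hc: "continuous_on ({0..1} \<times> {0..1}) h"
    unfolding h_def seg_def
    by (intro continuous_on_coordinatewise_then_product continuous_intros
        continuous_on_compose2[OF gi]) auto
  let ?f = "linepath (0, 0) (1, 0) +++ linepath (1, 0) (1 :: real, 1 :: real)"
  let ?g = "linepath (0, 0) (0, 1) +++ linepath (0, 1) (1 :: real, 1 :: real)"
  have conv: "convex ({0..1::real} \<times> {0..1::real})" by (intro convex_Times) auto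
  have seg_sub: "path_image (linepath a b) \<subseteq> {0..1} \<times> {0..1}"
    if "a \<in> {0..1} \<times> {0..1}" "b \<in> {0..1} \<times> {0..1}" for a b :: "real \<times> real"
    using that unfolding path_image_linepath by (rule closed_segment_subset[OF _ _ conv])
  have subf: "path_image ?f \<subseteq> {0..1} \<times> {0..1}"
    by (intro subset_path_image_join seg_sub; simp)
  have subg: "path_image ?g \<subseteq> {0..1} \<times> {0..1}"
    by (intro subset_path_image_join seg_sub; simp)
  have "homotopic_paths ({0..1} \<times> {0..1}) ?f ?g"
  proof (rule homotopic_paths_linear)
    fix t :: real assume "t \<in> {0..1}"
    then show "closed_segment (?f t) (?g t) \<subseteq> {0..1} \<times> {0..1}"
      using subf subg by (intro closed_segment_subset[OF _ _ conv]) (auto simp: path_image_def)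
  qed auto
  then have "homotopic_paths S (h \<circ> ?f) (h \<circ> ?g)"
    by (rule homotopic_paths_continuous_image[OF _ hc hS])
  moreover have "h \<circ> ?f = seg v (g 0) +++ g"
    by (auto simp: h_def linepath_def fun_eq_iff joinpaths_def seg_def)
  moreover have "h \<circ> ?g = (\<lambda>_. v) +++ seg v (g 1)"
    by (auto simp: h_def linepath_def fun_eq_iff joinpaths_def seg_def)
  moreover have "homotopic_paths S ((\<lambda>_. v) +++ seg v (g 1)) (seg v (g 1))"
    using star[of "g 1"] gS[of 1] by (intro homotopic_paths_const_join) auto
  ultimately show ?thesis by (metis homotopic_paths_trans)
qed

definition seg_convex :: "('i \<Rightarrow> real) set \<Rightarrow> bool" where
  "seg_convex S \<longleftrightarrow> (\<forall>x\<in>S. \<forall>y\<in>S. path_image (seg x y) \<subseteq> S)"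

lemma homotopic_paths_triangle:
  assumes "seg_convex S" "x \<in> S" "y \<in> S" "z \<in> S" "S \<subseteq> X"
  shows "homotopic_paths X (seg x y +++ seg y z) (seg x z)"
proof -
  have "homotopic_paths S (seg x (seg y z 0) +++ seg y z) (seg x (seg y z 1))"
    by (rule homotopic_paths_starlike) (use assms in \<open>auto simp: seg_convex_def\<close>)
  then show ?thesis using assms by (auto intro: homotopic_paths_subset)
qed

section \<open>Faces of the cube and commuting squares\<close>

lemma seg_convex_face: "seg_convex (cube_face n F v)"
  unfolding seg_convex_def
proof (intro ballI path_image_segI)
  fix x y and t :: real
  assume x: "x \<in> cube_face n F v" and y: "y \<in> cube_face n F v" and t: "0 \<le> t" "t \<le> 1"
  have "0 \<le> seg x y t i \<and> seg x y t i \<le> 1" if "i < n" for i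
  proof -
    have "0 \<le> x i" "x i \<le> 1" "0 \<le> y i" "y i \<le> 1"
      using x y that by (auto simp: cube_face_def cube_def)
    then show ?thesis using t convex_bound_le[of "x i" 1 "y i" "1 - t" t]
      by (auto simp: seg_def)
  qed
  moreover have "seg x y t i = 0" if "i \<ge> n" for i
    using x y that by (auto simp: cube_face_def cube_def seg_def)
  moreover have "seg x y t i = v i" if "i < n" "i \<notin> F" for i
    using x y that by (auto simp: cube_face_def seg_def algebra_simps)
  ultimately show "seg x y t \<in> cube_face n F v"
    by (auto simp: cube_face_def cube_def)
qed

definition flip :: "(nat \<Rightarrow> real) \<Rightarrow> nat \<Rightarrow> nat \<Rightarrow> real" where
  "flip v d = v(d := 1 - v d)"

lemma flip_flip [simp]: "flip (flip v d) d = v"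
  by (auto simp: flip_def)

lemma flip_commute: "flip (flip v d) e = flip (flip v e) d"
  by (cases "d = e") (auto simp: flip_def fun_upd_twist)

lemma flip_vertex [simp]: "v \<in> cube_vertices n \<Longrightarrow> d < n \<Longrightarrow> flip v d \<in> cube_vertices n"
  by (auto simp: cube_vertices_def flip_def)

lemma vertex_in_face [simp]: "v \<in> cube_vertices n \<Longrightarrow> v \<in> cube_face n F v"
  by (force simp: cube_face_def cube_vertices_def cube_def)

lemma flip_in_face [simp]: "w \<in> cube_face n F v \<Longrightarrow> w \<in> cube_vertices n \<Longrightarrow> d \<in> F \<Longrightarrow> d < n \<Longrightarrow> flip w d \<in> cube_face n F v"
  by (force simp: cube_face_def cube_vertices_def cube_def flip_def)

text \<open>
  The two edge paths around a square from \<open>v\<close> to the opposite corner are homotopic in \<open>X\<close>;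
  equivalently, the boundary of the square is null-homotopic in \<open>X\<close>. In this form a commuting square lets two successive flips change places.
\<close>

definition commuting :: "(nat \<Rightarrow> real) set \<Rightarrow> (nat \<Rightarrow> real) \<Rightarrow> nat \<Rightarrow> nat \<Rightarrow> bool" where
  "commuting X v i j \<longleftrightarrow> homotopic_paths X
     (seg v (flip v i) +++ seg (flip v i) (flip (flip v i) j))
     (seg v (flip v j) +++ seg (flip v j) (flip (flip v i) j))"

lemma commuting_sym: "commuting X v i j \<Longrightarrow> commuting X v j i"
  by (auto simp: commuting_def homotopic_paths_sym_eq flip_commute)

lemma commuting_face:
  assumes "v \<in> cube_vertices n" "i < n" "j < n" "cube_face n {i, j} v \<subseteq> X"
  shows "commuting X v i j"
proof -
  let ?F = "cube_face n {i, j} v"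
  have "homotopic_paths X (seg v (flip v d) +++ seg (flip v d) (flip (flip v i) j)) (seg v (flip (flip v i) j))"
    if "d \<in> {i, j}" for d
    by (rule homotopic_paths_triangle[OF seg_convex_face[of n "{i,j}" v]]) (use assms that in auto)
  from this[of i] this[of j] show ?thesis unfolding commuting_def
    by (metis homotopic_paths_sym homotopic_paths_trans insert_iff)
qed

text \<open>
  Five commuting faces of a 3-cube make the sixth commute. Among the paths from \<open>v\<close> to the
  opposite corner of the 3-cube, interchanging neighbouring flips gives
  \<open>ijk \<sim> ikj \<sim> kij \<sim> kji \<sim> jki \<sim> jik\<close>, using one of the five faces for each step;
  cancelling the last flip \<open>k\<close> leaves \<open>ij \<sim> ji\<close>.
\<close>

lemma commuting_cube:
  assumes edges: "\<And>u d. u \<in> cube_vertices n \<Longrightarrow> d < n \<Longrightarrow> path_image (seg u (flip u d)) \<subseteq> X"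
    and v: "v \<in> cube_vertices n" and ijk: "i < n" "j < n" "k < n"
    and ik: "commuting X v i k" and jk: "commuting X v j k"
    and ik': "commuting X (flip v j) i k" and jk': "commuting X (flip v i) j k"
    and ij: "commuting X (flip v k) i j"
  shows "commuting X v i j"
proof -
  define e where "e u d = seg u (flip u d)" for u and d
  have e: "path (e u d)" "e u d 0 = u" "e u d 1 = flip u d"
    "pathstart (e u d) = u" "pathfinish (e u d) = flip u d" for u d
    by (auto simp: e_def pathstart_def pathfinish_def)
  have eX: "path_image (e u d) \<subseteq> X" if "u \<in> cube_vertices n" "d < n" for u d
    using edges that by (auto simp: e_def)
  have C: "homotopic_paths X (e u a +++ e (flip u a) b) (e u b +++ e (flip u b) a)"
    if "commuting X u a b" for u a b
    using that by (simp add: commuting_def e_def flip_commute[of u b a])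
  have swap_end: "homotopic_paths X (e v a +++ (e (flip v a) b +++ e (flip (flip v a) b) c))
      (e v a +++ (e (flip v a) c +++ e (flip (flip v a) c) b))"
    if "commuting X (flip v a) b c" "a < n" for a b c
    by (rule homotopic_paths_join'[OF _ C[OF that(1)]]) (use v that in \<open>auto simp: e eX\<close>)
  have swap_start: "homotopic_paths X (e v a +++ (e (flip v a) b +++ e (flip (flip v a) b) c))
      (e v b +++ (e (flip v b) a +++ e (flip (flip v b) a) c))"
    if "commuting X v a b" "a < n" "b < n" "c < n" for a b c
  proof -
    have "homotopic_paths X (e v a +++ (e (flip v a) b +++ e (flip (flip v a) b) c))
        ((e v a +++ e (flip v a) b) +++ e (flip (flip v a) b) c)"
      by (rule homotopic_paths_sym, rule homotopic_paths_assoc_right) (use v that in \<open>auto simp: e eX\<close>)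
    also have "homotopic_paths X \<dots> ((e v b +++ e (flip v b) a) +++ e (flip (flip v a) b) c)"
      by (rule homotopic_paths_join'[OF C[OF that(1)]]) (use v that in \<open>auto simp: e eX\<close>)
    also have "(e v b +++ e (flip v b) a) +++ e (flip (flip v a) b) c = (e v b +++ e (flip v b) a) +++ e (flip (flip v b) a) c"
      by (simp add: flip_commute)
    also have "homotopic_paths X \<dots> (e v b +++ (e (flip v b) a +++ e (flip (flip v b) a) c))"
      by (rule homotopic_paths_assoc_right) (use v that in \<open>auto simp: e eX\<close>)
    finally show ?thesis .
  qed
  have "homotopic_paths X ((e v i +++ e (flip v i) j) +++ e (flip (flip v i) j) k)
      (e v i +++ (e (flip v i) j +++ e (flip (flip v i) j) k))"
    by (rule homotopic_paths_assoc_right) (use v ijk in \<open>auto simp: e eX\<close>)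
  also have "homotopic_paths X \<dots> (e v i +++ (e (flip v i) k +++ e (flip (flip v i) k) j))"
    using swap_end jk' ijk by blast
  also have "homotopic_paths X \<dots> (e v k +++ (e (flip v k) i +++ e (flip (flip v k) i) j))"
    using swap_start ik ijk by blast
  also have "homotopic_paths X \<dots> (e v k +++ (e (flip v k) j +++ e (flip (flip v k) j) i))"
    using swap_end ij ijk by blast
  also have "homotopic_paths X \<dots> (e v j +++ (e (flip v j) k +++ e (flip (flip v j) k) i))"
    using swap_start commuting_sym[OF jk] ijk by blast
  also have "homotopic_paths X \<dots> (e v j +++ (e (flip v j) i +++ e (flip (flip v j) i) k))"
    using swap_end commuting_sym[OF ik'] ijk by blast
  also have "homotopic_paths X \<dots> ((e v j +++ e (flip v j) i) +++ e (flip (flip v j) i) k)"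
    by (rule homotopic_paths_sym, rule homotopic_paths_assoc_right) (use v ijk in \<open>auto simp: e eX\<close>)
  also have "e (flip (flip v j) i) k = e (flip (flip v i) j) k"
    by (simp add: flip_commute)
  finally have "homotopic_paths X (e v i +++ e (flip v i) j) (e v j +++ e (flip v j) i)"
    by (rule homotopic_paths_cancel_right[rotated -1])
       (use v ijk in \<open>simp_all add: e path_image_join eX flip_commute[of v j i]\<close>)
  then show ?thesis by (simp add: commuting_def e_def flip_commute)
qed

section \<open>Simple connectivity from commuting squares\<close>

text \<open>
  Setting the coordinates \<open>\<ge> m\<close> of \<open>v\<close> to zero for \<open>m = 0, 1, \<dots>\<close> gives a canonical walk from the
  origin to \<open>v\<close>, which adjusts the coordinates in increasing order.
\<close>

definition trunc :: "nat \<Rightarrow> (nat \<Rightarrow> real) \<Rightarrow> nat \<Rightarrow> real" where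
  "trunc m v = (\<lambda>i. if i < m then v i else 0)"

primrec staircase :: "(nat \<Rightarrow> real) \<Rightarrow> nat \<Rightarrow> real \<Rightarrow> nat \<Rightarrow> real" where
  "staircase v 0 = (\<lambda>_ _. 0)"
\<comment> \<open>a constant segment if coordinate \<open>m\<close> of \<open>v\<close> is zero\<close>
| "staircase v (Suc m) = staircase v m +++ seg (trunc m v) (trunc (Suc m) v)"

definition nearest_vertex :: "nat \<Rightarrow> (nat \<Rightarrow> real) \<Rightarrow> nat \<Rightarrow> real" where
  "nearest_vertex n x = (\<lambda>i. if i < n \<and> 1/2 \<le> x i then 1 else 0)"

lemma trunc_vertex [simp]: "v \<in> cube_vertices n \<Longrightarrow> trunc m v \<in> cube_vertices n"
  by (auto simp: trunc_def cube_vertices_def)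

lemma trunc_dim: "v \<in> cube_vertices n \<Longrightarrow> trunc n v = v"
  by (auto simp: trunc_def cube_vertices_def fun_eq_iff)

lemma trunc_Suc_cases:
  assumes "v \<in> cube_vertices n" "m < n"
  shows "trunc (Suc m) v = trunc m v \<or> trunc (Suc m) v = flip (trunc m v) m"
  using assms by (auto simp: trunc_def cube_vertices_def flip_def fun_eq_iff less_Suc_eq)

lemma trunc_flip: "d < m \<Longrightarrow> trunc m (flip v d) = flip (trunc m v) d"
  by (auto simp: trunc_def flip_def fun_eq_iff)

lemma trunc_flip_ge: "m \<le> d \<Longrightarrow> trunc m (flip v d) = trunc m v"
  by (auto simp: trunc_def flip_def fun_eq_iff)

lemma staircase_flip_ge: "m \<le> d \<Longrightarrow> staircase (flip v d) m = staircase v m"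
  by (induction m) (auto simp: trunc_flip_ge)

lemma nearest_vertex [simp]: "nearest_vertex n x \<in> cube_vertices n"
  by (auto simp: nearest_vertex_def cube_vertices_def)

text \<open>
  A subcomplex of the cube, of any dimension, with full 1-skeleton and such that every square of the
  cube, whether it belongs to the complex or not, has a null-homotopic boundary in it.
\<close>

locale commuting_cubical_complex =
  fixes n :: nat and K :: "(nat \<Rightarrow> real) set set"
  assumes cells: "\<sigma> \<in> K \<Longrightarrow> \<exists>F v. v \<in> cube_vertices n \<and> \<sigma> = cube_face n F v"
    and vertices: "cube_vertices n \<subseteq> \<Union>K"
    and edges: "v \<in> cube_vertices n \<Longrightarrow> d < n \<Longrightarrow> cube_face n {d} v \<in> K"
    and squares: "v \<in> cube_vertices n \<Longrightarrow> i < n \<Longrightarrow> j < n \<Longrightarrow> i \<noteq> j \<Longrightarrow> commuting (\<Union>K) v i j"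
begin

lemma cell_convex: "\<sigma> \<in> K \<Longrightarrow> seg_convex \<sigma>"
  using cells seg_convex_face by metis

lemma seg_in_cell:
  "\<sigma> \<in> K \<Longrightarrow> x \<in> \<sigma> \<Longrightarrow> y \<in> \<sigma> \<Longrightarrow> path_image (seg x y) \<subseteq> \<Union>K"
  using cell_convex[of \<sigma>] unfolding seg_convex_def by blast

lemma edge_image:
  assumes "v \<in> cube_vertices n" "d < n"
  shows "path_image (seg v (flip v d)) \<subseteq> \<Union>K"
  by (rule seg_in_cell[OF edges[OF assms]]) (use assms in auto)

lemma trunc_step_cell:
  assumes "v \<in> cube_vertices n" "m < n"
  shows "\<exists>\<sigma>\<in>K. trunc m v \<in> \<sigma> \<and> trunc (Suc m) v \<in> \<sigma>"
  by (rule bexI[OF _ edges[of "trunc m v" m]]) (use assms trunc_Suc_cases[of v n m] in auto)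

lemma staircase_path:
  assumes v: "v \<in> cube_vertices n" and "m \<le> n"
  shows "path (staircase v m) \<and> path_image (staircase v m) \<subseteq> \<Union>K \<and>
    staircase v m 0 = (\<lambda>_. 0) \<and> staircase v m 1 = trunc m v"
  using \<open>m \<le> n\<close>
proof (induction m)
  case 0
  have "(\<lambda>_. 0) \<in> cube_vertices n" by (auto simp: cube_vertices_def)
  then show ?case using vertices by (auto simp: path_image_def trunc_def)
next
  case (Suc m)
  obtain \<sigma> where "\<sigma> \<in> K" "trunc m v \<in> \<sigma>" "trunc (Suc m) v \<in> \<sigma>"
    using trunc_step_cell[OF v, of m] Suc.prems by auto
  then have "path_image (seg (trunc m v) (trunc (Suc m) v)) \<subseteq> \<Union>K"
    by (rule seg_in_cell)
  with Suc show ?case by (auto simp: pathstart_def pathfinish_def subset_path_image_join)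
qed

lemma square_step:
  assumes u: "u \<in> cube_vertices n" and d: "d < n" "m < n" "d \<noteq> m" and u': "u' = u \<or> u' = flip u m"
  shows "homotopic_paths (\<Union>K) (seg u u' +++ seg u' (flip u' d)) (seg u (flip u d) +++ seg (flip u d) (flip u' d))"
  using u'
proof
  assume eq: "u' = u"
  have tri: "homotopic_paths (\<Union>K) (seg u w +++ seg w (flip u d)) (seg u (flip u d))"
    if "w = u \<or> w = flip u d" for w
    by (rule homotopic_paths_triangle[OF seg_convex_face[of n "{d}" u]])
       (use u d edges[of u d] that in auto)
  show ?thesis
    using tri[of u] tri[of "flip u d"] by (simp add: eq) (metis homotopic_paths_sym homotopic_paths_trans)
next
  assume "u' = flip u m"
  then show ?thesis
    using squares[OF u, of m d] d by (simp add: commuting_def flip_commute)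
qed

text \<open>
  Rewriting \<open>p s\<close> to \<open>p q r\<close> and then to \<open>p' r\<close>: a triangle or square on the right lets the
  canonical path on the left change its end point.
\<close>

lemma homotopic_paths_move_left:
  assumes "homotopic_paths (\<Union>K) (p +++ q) p'" "homotopic_paths (\<Union>K) (q +++ r) s"
    and "path p" "path_image p \<subseteq> \<Union>K" "path q" "path_image q \<subseteq> \<Union>K" "path r" "path_image r \<subseteq> \<Union>K"
    and "p 1 = q 0" "q 1 = r 0"
  shows "homotopic_paths (\<Union>K) (p +++ s) (p' +++ r)"
proof -
  have "homotopic_paths (\<Union>K) (p +++ s) (p +++ (q +++ r))"
    using assms homotopic_paths_ends(5)[OF assms(2)]
    by (intro homotopic_paths_join') (auto simp: homotopic_paths_sym)
  also have "homotopic_paths (\<Union>K) \<dots> ((p +++ q) +++ r)"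
    by (rule homotopic_paths_sym, rule homotopic_paths_assoc_right) (use assms in auto)
  also have "homotopic_paths (\<Union>K) \<dots> (p' +++ r)"
    by (rule homotopic_paths_join'[OF assms(1)]) (use assms in auto)
  finally show ?thesis .
qed

text \<open>
  Canonical paths are compatible with every edge. Let \<open>m\<close> be the last coordinate that the walk
  adjusts. An edge in direction \<open>m\<close> is compatible because the last steps of both walks lie in one edge
  of the cube; an edge in direction \<open>d < m\<close> is moved past the step in direction \<open>m\<close> across a commuting
  square and is then handled by induction.
\<close>

lemma staircase_flip:
  assumes v: "v \<in> cube_vertices n" and "d < m" "m \<le> n"
  shows "homotopic_paths (\<Union>K) (staircase v m +++ seg (trunc m v) (flip (trunc m v) d)) (staircase (flip v d) m)"
  using assms(2,3)
proof (induction m)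
  case (Suc m)
  let ?u = "trunc m v" and ?u' = "trunc (Suc m) v"
  have u: "?u \<in> cube_vertices n" "?u' \<in> cube_vertices n" using v by auto
  have u': "?u' = ?u \<or> ?u' = flip ?u m" using trunc_Suc_cases[OF v] Suc.prems by auto
  have st: "path (staircase w k)" "path_image (staircase w k) \<subseteq> \<Union>K"
    "staircase w k 1 = trunc k w" if "w \<in> cube_vertices n" "k \<le> n" for w k
    using staircase_path[OF that] by auto
  have seg: "path_image (seg ?u ?u') \<subseteq> \<Union>K"
    using trunc_step_cell[OF v, of m] seg_in_cell Suc.prems by (metis Suc_le_lessD)
  have assoc: "homotopic_paths (\<Union>K) ((staircase v m +++ seg ?u ?u') +++ seg ?u' (flip ?u' d))
      (staircase v m +++ (seg ?u ?u' +++ seg ?u' (flip ?u' d)))"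
    by (rule homotopic_paths_assoc_right) (use st seg edge_image[OF u(2), of d] v Suc.prems in auto)
  show ?case
  proof (cases "d = m")
    case True
    have f: "trunc (Suc m) (flip v m) = flip ?u' m" by (simp add: trunc_flip)
    have "homotopic_paths (\<Union>K) (seg ?u ?u' +++ seg ?u' (flip ?u' m)) (seg ?u (flip ?u' m))"
      by (rule homotopic_paths_triangle[OF seg_convex_face[of n "{m}" ?u]])
         (use u u' edges[of ?u m] Suc.prems in auto)
    then have "homotopic_paths (\<Union>K) (staircase v m +++ (seg ?u ?u' +++ seg ?u' (flip ?u' m)))
        (staircase v m +++ seg ?u (flip ?u' m))"
      by (intro homotopic_paths_join') (use st[OF v, of m] Suc.prems in auto)
    with assoc show ?thesis
      by (simp add: True staircase_flip_ge trunc_flip_ge f) (rule homotopic_paths_trans)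
  next
    case False
    then have d: "d < m" "d < n" "m < n" using Suc.prems by auto
    have "homotopic_paths (\<Union>K) (staircase v m +++ (seg ?u ?u' +++ seg ?u' (flip ?u' d)))
        (staircase (flip v d) m +++ seg (flip ?u d) (flip ?u' d))"
    proof (rule homotopic_paths_move_left)
      show "homotopic_paths (\<Union>K) (staircase v m +++ seg ?u (flip ?u d)) (staircase (flip v d) m)"
        using Suc d by auto
      show "homotopic_paths (\<Union>K) (seg ?u (flip ?u d) +++ seg (flip ?u d) (flip ?u' d))
          (seg ?u ?u' +++ seg ?u' (flip ?u' d))"
        by (rule homotopic_paths_sym, rule square_step[OF u(1) d(2,3) _ u']) (use d in auto)
      show "path_image (seg (flip ?u d) (flip ?u' d)) \<subseteq> \<Union>K"
        using trunc_step_cell[of "flip v d" m] seg_in_cell flip_vertex[OF v d(2)] d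
        by (metis trunc_flip less_SucI)
    qed (use st[OF v, of m] d edge_image[OF u(1) d(2)] in auto)
    with assoc show ?thesis
      using d by (simp add: trunc_flip) (rule homotopic_paths_trans)
  qed
qed simp

abbreviation to_vertex :: "(nat \<Rightarrow> real) \<Rightarrow> real \<Rightarrow> nat \<Rightarrow> real" where
  "to_vertex v \<equiv> staircase v n"

lemma to_vertex:
  assumes "v \<in> cube_vertices n"
  shows "path (to_vertex v)" "path_image (to_vertex v) \<subseteq> \<Union>K" "to_vertex v 0 = (\<lambda>_. 0)" "to_vertex v 1 = v"
  using staircase_path[OF assms, of n] trunc_dim[OF assms] by auto

text \<open>
  If the edge path to \<open>w\<close> may be routed through \<open>v\<close>, then any point of a common cell may be reached
  through \<open>v\<close> or through \<open>w\<close>, because triangles in a cell contract.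
\<close>

lemma to_vertex_shift:
  assumes v: "v \<in> cube_vertices n" and "\<sigma> \<in> K" "v \<in> \<sigma>" "w \<in> \<sigma>" "x \<in> \<sigma>"
    and h: "homotopic_paths (\<Union>K) (to_vertex v +++ seg v w) (to_vertex w)"
  shows "homotopic_paths (\<Union>K) (to_vertex v +++ seg v x) (to_vertex w +++ seg w x)"
  by (rule homotopic_paths_move_left[OF h homotopic_paths_triangle[OF cell_convex[OF assms(2)]]])
     (use assms to_vertex[OF v] seg_in_cell[of \<sigma>] in auto)

text \<open>
  Any two vertices of a cell are joined inside that cell by flips of the coordinates in which they
  differ, so compatibility with edges extends to diagonals of cells.
\<close>

lemma to_vertex_cell:
  assumes "\<sigma> \<in> K" "v \<in> cube_vertices n" "w \<in> cube_vertices n" "v \<in> \<sigma>" "w \<in> \<sigma>"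
  shows "homotopic_paths (\<Union>K) (to_vertex v +++ seg v w) (to_vertex w)"
  using assms
proof (induction "card {i. i < n \<and> v i \<noteq> w i}" arbitrary: v)
  case 0
  then have "v i = w i" if "i < n" for i using that by auto
  moreover have "v i = w i" if "i \<ge> n" for i using that 0 by (auto simp: cube_vertices_def)
  ultimately have "v = w" by (metis ext not_le_imp_less)
  then show ?case using homotopic_paths_join_const[of "to_vertex w" "\<Union>K"] to_vertex[of w] 0
    by (simp add: seg_refl)
next
  case (Suc k)
  from Suc(2) have "{i. i < n \<and> v i \<noteq> w i} \<noteq> {}" by (metis card.empty nat.distinct(1))
  then obtain d where d: "d < n" "v d \<noteq> w d" by auto
  let ?v = "flip v d"
  obtain F u where F: "\<sigma> = cube_face n F u" using cells Suc by blast
  have "v d = u d" "w d = u d" if "d \<notin> F"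
    using that d(1) Suc.prems(4,5) unfolding F cube_face_def by auto
  then have "d \<in> F" using d(2) by metis
  then have v': "?v \<in> \<sigma>" "?v \<in> cube_vertices n" using Suc.prems d F by auto
  have "?v d = w d" using d Suc.prems by (auto simp: flip_def cube_vertices_def) fastforce+
  then have "{i. i < n \<and> v i \<noteq> w i} = insert d {i. i < n \<and> ?v i \<noteq> w i}"
    using d by (auto simp: flip_def)
  moreover have "d \<notin> {i. i < n \<and> ?v i \<noteq> w i}" using \<open>?v d = w d\<close> by auto
  ultimately have "k = card {i. i < n \<and> ?v i \<noteq> w i}" using Suc(2) by simp
  then have IH: "homotopic_paths (\<Union>K) (to_vertex ?v +++ seg ?v w) (to_vertex w)"
    using Suc v' by blast
  have "homotopic_paths (\<Union>K) (to_vertex v +++ seg v ?v) (to_vertex ?v)"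
    using staircase_flip[of v d n] Suc.prems d by (simp add: trunc_dim)
  from to_vertex_shift[OF _ _ _ _ _ this] show ?case
    using Suc.prems v' IH homotopic_paths_trans by blast
qed

text \<open>
  The union of the relatively open cells of the complex whose closure contains the vertex \<open>v\<close>: a
  point lies in it unless one of its coordinates has reached the facet opposite to \<open>v\<close>.
\<close>

definition open_star :: "(nat \<Rightarrow> real) \<Rightarrow> (nat \<Rightarrow> real) set" where
  "open_star v = {x \<in> \<Union>K. \<forall>i<n. x i \<noteq> 1 - v i}"

lemma vertex_in_cell:
  assumes "\<sigma> \<in> K" "x \<in> \<sigma>" "x \<in> open_star v" "v \<in> cube_vertices n"
  shows "v \<in> \<sigma>"
proof -
  obtain F u where F: "\<sigma> = cube_face n F u" "u \<in> cube_vertices n" using cells assms by blast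
  have "v i = u i" if "i < n" "i \<notin> F" for i
  proof -
    have "x i = u i" "x i \<noteq> 1 - v i" using that assms F by (auto simp: open_star_def cube_face_def)
    moreover have "u i = 0 \<or> u i = 1" "v i = 0 \<or> v i = 1"
      using that assms F by (auto simp: cube_vertices_def)
    ultimately show ?thesis by auto
  qed
  moreover have "v \<in> cube n" using assms by (force simp: cube_vertices_def cube_def)
  ultimately show ?thesis by (auto simp: F cube_face_def)
qed

lemma cell_in_cube: "\<sigma> \<in> K \<Longrightarrow> x \<in> \<sigma> \<Longrightarrow> x \<in> cube n"
  using cells by (auto simp: cube_face_def)

lemma open_star_starlike:
  assumes v: "v \<in> cube_vertices n" and x: "x \<in> open_star v"
  shows "path_image (seg v x) \<subseteq> open_star v"
proof (rule path_image_segI)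
  fix t :: real assume t: "0 \<le> t" "t \<le> 1"
  obtain \<sigma> where \<sigma>: "\<sigma> \<in> K" "x \<in> \<sigma>" using x by (auto simp: open_star_def)
  have "seg v x t \<in> \<sigma>"
    using cell_convex[OF \<sigma>(1)] vertex_in_cell[OF \<sigma> x v] \<sigma>(2) t
    by (auto simp: seg_convex_def path_image_def image_subset_iff)
  moreover have "seg v x t i \<noteq> 1 - v i" if i: "i < n" for i
  proof
    assume eq: "seg v x t i = 1 - v i"
    have xi: "0 \<le> x i" "x i \<le> 1" using cell_in_cube[OF \<sigma>] i by (auto simp: cube_def)
    have ne: "x i \<noteq> 1 - v i" using x i by (auto simp: open_star_def)
    have "v i = 0 \<or> v i = 1" using v i by (auto simp: cube_vertices_def)
    then show False
    proof
      assume v0: "v i = 0"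
      then have "t * x i = 1" using eq by (simp add: seg_def)
      moreover have "t * x i \<le> x i" using t xi mult_right_mono[of t 1 "x i"] by simp
      ultimately show False using v0 ne xi by simp
    next
      assume v1: "v i = 1"
      then have "t * (1 - x i) = 1" using eq by (simp add: seg_def algebra_simps)
      moreover have "t * (1 - x i) \<le> 1 - x i" using t xi mult_right_mono[of t 1 "1 - x i"] by simp
      ultimately show False using v1 ne xi by simp
    qed
  qed
  ultimately show "seg v x t \<in> open_star v" using \<sigma> by (auto simp: open_star_def)
qed

lemma nearest_vertex_star: "x \<in> \<Union>K \<Longrightarrow> x \<in> open_star (nearest_vertex n x)"
  by (auto simp: open_star_def nearest_vertex_def)

definition to_point :: "(nat \<Rightarrow> real) \<Rightarrow> real \<Rightarrow> nat \<Rightarrow> real" where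
  "to_point x = to_vertex (nearest_vertex n x) +++ seg (nearest_vertex n x) x"

text \<open>
  The canonical path to a point may be routed through any vertex whose open star contains the point:
  all such vertices lie in one cell with the point.
\<close>

lemma to_point_star:
  assumes v: "v \<in> cube_vertices n" and x: "x \<in> open_star v"
  shows "homotopic_paths (\<Union>K) (to_point x) (to_vertex v +++ seg v x)"
proof -
  obtain \<sigma> where \<sigma>: "\<sigma> \<in> K" "x \<in> \<sigma>" using x by (auto simp: open_star_def)
  then have "nearest_vertex n x \<in> \<sigma>" "v \<in> \<sigma>"
    using vertex_in_cell x v nearest_vertex_star by (auto simp: open_star_def)
  then show ?thesis unfolding to_point_def
    using \<sigma> v by (intro to_vertex_shift to_vertex_cell) auto
qed

lemma to_point_local:
  assumes v: "v \<in> cube_vertices n" and g: "path g" "path_image g \<subseteq> open_star v"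
  shows "homotopic_paths (\<Union>K) (to_point (g 0) +++ g) (to_point (g 1))"
proof -
  have sub: "open_star v \<subseteq> \<Union>K" by (auto simp: open_star_def)
  have ends: "g 0 \<in> open_star v" "g 1 \<in> open_star v" using g by (auto simp: path_image_def)
  have segX: "path_image (seg v (g 0)) \<subseteq> \<Union>K" using open_star_starlike[OF v ends(1)] sub by simp
  have "homotopic_paths (\<Union>K) (to_point (g 0) +++ g) ((to_vertex v +++ seg v (g 0)) +++ g)"
    using to_point_star[OF v ends(1)] g sub by (intro homotopic_paths_join') (auto simp: to_point_def)
  also have "homotopic_paths (\<Union>K) \<dots> (to_vertex v +++ (seg v (g 0) +++ g))"
    by (rule homotopic_paths_assoc_right) (use to_vertex[OF v] segX g sub in auto)
  also have "homotopic_paths (\<Union>K) \<dots> (to_vertex v +++ seg v (g 1))"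
  proof (rule homotopic_paths_join')
    show "homotopic_paths (\<Union>K) (seg v (g 0) +++ g) (seg v (g 1))"
      using homotopic_paths_starlike[OF open_star_starlike[OF v] g] sub
      by (rule homotopic_paths_subset)
  qed (use to_vertex[OF v] in auto)
  also have "homotopic_paths (\<Union>K) \<dots> (to_point (g 1))"
    using to_point_star[OF v ends(2)] by (rule homotopic_paths_sym)
  finally show ?thesis .
qed

text \<open>
  If no coordinate of \<open>g\<close> varies by \<open>1/2\<close> or more on a piece, then the piece stays in the open star
  of the vertex nearest to its first point.
\<close>

lemma path_subdivision:
  assumes g: "path g" "path_image g \<subseteq> \<Union>K"
  obtains N :: nat where "N > 0"
    "\<And>k. k < N \<Longrightarrow> \<exists>v\<in>cube_vertices n. g ` {real k / N..real (Suc k) / N} \<subseteq> open_star v"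
proof -
  have "\<exists>\<delta>>0. \<forall>s\<in>{0..1}. \<forall>t\<in>{0..1}. \<bar>s - t\<bar> < \<delta> \<longrightarrow> \<bar>g s i - g t i\<bar> < 1/2" for i
  proof -
    have "continuous_on {0..1} (\<lambda>t. g t i)"
      using g by (auto simp: path_def intro: continuous_on_product_then_coordinatewise)
    then have "uniformly_continuous_on {0..1} (\<lambda>t. g t i)"
      by (simp add: compact_uniformly_continuous)
    then show ?thesis
      unfolding uniformly_continuous_on_def
      by (drule_tac x = "1/2" in spec) (auto simp: dist_real_def abs_minus_commute)
  qed
  then obtain \<delta> where \<delta>: "\<And>i. \<delta> i > 0"
    "\<And>i s t. s \<in> {0..1} \<Longrightarrow> t \<in> {0..1} \<Longrightarrow> \<bar>s - t\<bar> < \<delta> i \<Longrightarrow> \<bar>g s i - g t i\<bar> < 1/2"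
    by metis
  define \<epsilon> where "\<epsilon> = Min (insert 1 (\<delta> ` {..<n}))"
  have \<epsilon>: "\<epsilon> > 0" "\<And>i. i < n \<Longrightarrow> \<epsilon> \<le> \<delta> i"
    using \<delta>(1) by (auto simp: \<epsilon>_def)
  obtain N :: nat where N: "N > 0" "1 / real N < \<epsilon>"
    using \<epsilon>(1) real_arch_inverse[of \<epsilon>] by (auto simp: inverse_eq_divide)
  show thesis
  proof (rule that[OF N(1)])
    fix k assume k: "k < N"
    define s where "s = real k / N"
    have s: "s \<in> {0..1}" using k by (auto simp: s_def)
    have e: "real (Suc k) / N = s + 1 / N" by (simp add: s_def add_divide_distrib)
    have e1: "real (Suc k) / N \<le> 1" using k by auto
    have "g t \<in> open_star (nearest_vertex n (g s))" if t: "t \<in> {s..real (Suc k) / N}" for t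
    proof -
      have t01: "t \<in> {0..1}" using t s e1 by auto
      have "g t \<in> \<Union>K" using g t01 unfolding path_image_def by blast
      moreover have "g t i \<noteq> 1 - nearest_vertex n (g s) i" if i: "i < n" for i
      proof -
        have "\<bar>s - t\<bar> \<le> 1 / N" using t e by auto
        then have "\<bar>g s i - g t i\<bar> < 1/2" using \<delta>(2)[OF s t01, of i] N(2) \<epsilon>(2)[OF i] by linarith
        then show ?thesis by (auto simp: nearest_vertex_def i)
      qed
      ultimately show ?thesis by (auto simp: open_star_def)
    qed
    then show "\<exists>v\<in>cube_vertices n. g ` {real k / N..real (Suc k) / N} \<subseteq> open_star v"
      by (auto simp: s_def intro!: bexI[of _ "nearest_vertex n (g s)"])
  qed
qed

lemma to_point:
  assumes "x \<in> \<Union>K"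
  shows "path (to_point x)" "path_image (to_point x) \<subseteq> \<Union>K" "to_point x 0 = (\<lambda>_. 0)" "to_point x 1 = x"
  using homotopic_paths_ends[OF to_point_star[OF nearest_vertex nearest_vertex_star[OF assms]]] to_vertex
  by (auto simp: to_point_def)

text \<open>
  The canonical path to the start of \<open>g\<close>, continued along \<open>g\<close>, is the canonical path to the end of
  \<open>g\<close>. This holds on each piece of a fine subdivision, and the pieces compose. For a loop at \<open>x\<close>
  it leaves \<open>to_point x\<close> on both sides, and cancelling that path shows that the loop is
  null-homotopic.
\<close>

lemma to_point_transport:
  assumes g: "path g" "path_image g \<subseteq> \<Union>K"
  shows "homotopic_paths (\<Union>K) (to_point (g 0) +++ g) (to_point (g 1))"
proof -
  obtain N :: nat where N: "N > 0"
    "\<And>k. k < N \<Longrightarrow> \<exists>v\<in>cube_vertices n. g ` {real k / N..real (Suc k) / N} \<subseteq> open_star v"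
    by (rule path_subdivision[OF g]) blast
  have gX: "g t \<in> \<Union>K" if "t \<in> {0..1}" for t using g that unfolding path_image_def by blast
  have "homotopic_paths (\<Union>K) (to_point (g 0) +++ (g \<circ> linepath 0 (real k / N))) (to_point (g (real k / N)))"
    if "k \<le> N" for k
    using that
  proof (induction k)
    case 0
    have "(g \<circ> linepath 0 0) = (\<lambda>_. g 0)" by (auto simp: linepath_def)
    then show ?case using to_point[OF gX[of 0]] by (simp add: homotopic_paths_join_const)
  next
    case (Suc k)
    define s t where "s = real k / N" and "t = real (Suc k) / N"
    have st: "s \<in> {0..1}" "t \<in> {0..1}" "s \<le> t" using Suc.prems N(1) by (auto simp: s_def t_def divide_right_mono)
    have sp: "path ((g \<circ> linepath a b))" "path_image ((g \<circ> linepath a b)) \<subseteq> \<Union>K"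
      if "a \<in> {0..1}" "b \<in> {0..1}" for a b
    proof -
      have ab: "path_image (linepath a b) \<subseteq> {0..1}"
        using that by (auto simp: closed_segment_eq_real_ivl split: if_splits)
      show "path (g \<circ> linepath a b)"
        using g(1) continuous_on_subset[OF _ ab, of g] by (intro path_continuous_image path_linepath) (simp add: path_def)
      show "path_image (g \<circ> linepath a b) \<subseteq> \<Union>K"
        using order_trans[OF image_mono[OF ab] g(2)[unfolded path_image_def]]
        by (simp only: path_image_compose)
    qed
    have spe: "(g \<circ> linepath a b) 0 = g a" "(g \<circ> linepath a b) 1 = g b"
      "linepath a b 0 = a" "linepath a b 1 = b" for a b :: real
      by (auto simp: linepath_def)
    have IH: "homotopic_paths (\<Union>K) (to_point (g 0) +++ (g \<circ> linepath 0 s)) (to_point (g s))"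
      unfolding s_def by (rule Suc.IH) (use Suc.prems in simp)
    obtain v where v: "v \<in> cube_vertices n" "g ` {s..t} \<subseteq> open_star v"
      using N(2)[of k] Suc.prems by (auto simp: s_def t_def)
    have "homotopic_paths (\<Union>K) (to_point (g 0) +++ (g \<circ> linepath 0 t))
        (to_point (g 0) +++ ((g \<circ> linepath 0 s) +++ (g \<circ> linepath s t)))"
      by (intro homotopic_paths_join' homotopic_paths_sym[OF homotopic_paths_join_pieces])
         (use g st to_point[OF gX] in \<open>auto simp: spe\<close>)
    also have "homotopic_paths (\<Union>K) \<dots> ((to_point (g 0) +++ (g \<circ> linepath 0 s)) +++ (g \<circ> linepath s t))"
      by (rule homotopic_paths_sym, rule homotopic_paths_assoc_right)
         (use st sp to_point[OF gX] in \<open>auto simp: spe\<close>)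
    also have "homotopic_paths (\<Union>K) \<dots> (to_point (g s) +++ (g \<circ> linepath s t))"
      by (rule homotopic_paths_join'[OF IH]) (use st sp in \<open>auto simp: spe\<close>)
    also have "homotopic_paths (\<Union>K) \<dots> (to_point (g t))"
      using to_point_local[OF v(1), of "(g \<circ> linepath s t)"] sp[OF st(1,2)] st v(2)
      by (simp add: spe path_image_compose closed_segment_eq_real_ivl)
    finally show ?case unfolding t_def .
  qed
  from this[of N] N(1) have "homotopic_paths (\<Union>K) (to_point (g 0) +++ (g \<circ> linepath 0 1)) (to_point (g 1))"
    by simp
  moreover have "g \<circ> linepath 0 1 = g" by (auto simp: linepath_def)
  ultimately show ?thesis by simp
qed

lemma loop_null:
  assumes "path g" "path_image g \<subseteq> \<Union>K" "g 0 = x" "g 1 = x"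
  shows "homotopic_paths (\<Union>K) g (\<lambda>_. x)"
proof -
  have x: "x \<in> \<Union>K" using assms unfolding path_image_def by (metis atLeastAtMost_iff image_subset_iff order_refl zero_le_one)
  have "homotopic_paths (\<Union>K) (to_point x +++ (\<lambda>_. x)) (to_point x)"
    using to_point[OF x] by (intro homotopic_paths_join_const)
  then have "homotopic_paths (\<Union>K) (to_point x +++ g) (to_point x +++ (\<lambda>_. x))"
    using to_point_transport[OF assms(1,2)] assms by (metis homotopic_paths_sym homotopic_paths_trans)
  then show ?thesis
    by (rule homotopic_paths_cancel_left[rotated -1]) (use to_point[OF x] x assms in \<open>simp_all add: path_image_def\<close>)
qed

lemma trivial_fundamental_group:
  assumes x: "x \<in> \<Union>K"
  shows "trivial_group (fundamental_group (\<Union>K) x)" (is "trivial_group ?G")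
proof -
  let ?c = "\<lambda>_. x"
  have c: "path ?c" "path_image ?c \<subseteq> \<Union>K" "pathstart ?c = x" "pathfinish ?c = x"
    using x by (auto simp: path_image_def pathstart_def pathfinish_def)
  have one: "\<one>\<^bsub>?G\<^esub> = loop_class (\<Union>K) ?c" by (simp add: fundamental_group_def)
  have carrier: "carrier ?G = {\<one>\<^bsub>?G\<^esub>}"
  proof
    show "carrier ?G \<subseteq> {\<one>\<^bsub>?G\<^esub>}"
    proof
      fix a assume "a \<in> carrier ?G"
      then obtain f where f: "a = loop_class (\<Union>K) f" "path f" "path_image f \<subseteq> \<Union>K" "pathstart f = x" "pathfinish f = x"
        by (auto simp: fundamental_group_def)
      have "homotopic_paths (\<Union>K) f ?c" by (rule loop_null) (use f in \<open>auto simp: pathstart_def pathfinish_def\<close>)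
      then show "a \<in> {\<one>\<^bsub>?G\<^esub>}" using f(1) loop_class_eq one by auto
    qed
    show "{\<one>\<^bsub>?G\<^esub>} \<subseteq> carrier ?G"
    proof -
      have "loop_class (\<Union>K) ?c \<in> carrier ?G"
        unfolding fundamental_group_def partial_object.simps using c by blast
      then show ?thesis by (simp add: one)
    qed
  qed
  have "\<one>\<^bsub>?G\<^esub> \<otimes>\<^bsub>?G\<^esub> \<one>\<^bsub>?G\<^esub> = loop_class (\<Union>K) (?c +++ ?c)"
    unfolding one by (rule fundamental_group_mult) (use c in auto)
  also have "?c +++ ?c = ?c" by (auto simp: joinpaths_def)
  finally have mult: "\<one>\<^bsub>?G\<^esub> \<otimes>\<^bsub>?G\<^esub> \<one>\<^bsub>?G\<^esub> = \<one>\<^bsub>?G\<^esub>" using one by simp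
  have "group ?G"
    by (rule groupI) (auto simp: carrier mult)
  then show ?thesis using carrier by (simp add: trivial_group_def)
qed

end

section \<open>Contracting a square in two layers\<close>

text \<open>
  The faces of the 3-cube at \<open>a\<close> in directions \<open>d\<close>, \<open>k\<close>, \<open>l\<close> other than the square \<open>(d, k)\<close> at \<open>a\<close>
  and the square \<open>(d, l)\<close> at \<open>a\<close>. If these four and the square \<open>(d, l)\<close> at \<open>a\<close> are present, then the
  square \<open>(d, k)\<close> at \<open>a\<close> commutes. The square \<open>(d, l)\<close> is left out because it does not depend on
  \<open>k\<close>: it is provided once for all \<open>k\<close> by the choice of \<open>l\<close>.
\<close>

definition prism :: "nat \<Rightarrow> (nat \<Rightarrow> real) \<Rightarrow> nat \<Rightarrow> nat \<Rightarrow> nat \<Rightarrow> (nat \<Rightarrow> real) set set" where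
  "prism n a d k l = {cube_face n {d, l} (flip a k), cube_face n {d, k} (flip a l),
     cube_face n {k, l} a, cube_face n {k, l} (flip a d)}"

text \<open>
  An edge is encoded by a vertex and the direction in which to leave it. For each of the four edges
  of a square, the vertex is the corner at which \<open>commuting_cube\<close> requires the side square over that
  edge to commute.
\<close>

definition square_edges :: "(nat \<Rightarrow> real) \<Rightarrow> nat \<Rightarrow> nat \<Rightarrow> ((nat \<Rightarrow> real) \<times> nat) set" where
  "square_edges v i j = {(v, i), (flip v j, i), (v, j), (flip v i, j)}"

text \<open>
  Direction \<open>k\<close> succeeds for the square \<open>(i, j)\<close> at \<open>v\<close>: the parallel square at distance one in
  direction \<open>k\<close> is present, and the four side squares between the two are contracted through
  further 3-cubes, with auxiliary directions \<open>l\<close> taken from the set \<open>L e\<close> attached to the edge \<open>e\<close>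
  below the side square.
\<close>

definition capped :: "nat \<Rightarrow> (nat \<Rightarrow> real) \<Rightarrow> nat \<Rightarrow> nat \<Rightarrow> ((nat \<Rightarrow> real) \<times> nat \<Rightarrow> nat set) \<Rightarrow> nat
    \<Rightarrow> ((nat \<Rightarrow> real) set \<Rightarrow> bool) set" where
  "capped n v i j L k = {\<omega>. \<omega> (cube_face n {i, j} (flip v k)) \<and>
     (\<forall>(a, d)\<in>square_edges v i j. \<exists>l\<in>L (a, d). \<forall>\<sigma>\<in>prism n a d k l. \<omega> \<sigma>)}"

lemma finite_square_edges [simp]: "finite (square_edges v i j)"
  and card_square_edges: "card (square_edges v i j) \<le> 4"
proof -
  show "finite (square_edges v i j)" by (simp add: square_edges_def)
  show "card (square_edges v i j) \<le> 4"
    using card_length[of "[(v, i), (flip v j, i), (v, j), (flip v i, j)]"] by (simp add: square_edges_def)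
qed

lemma square_face:
  assumes "w \<in> cube_vertices n" "a < n" "b < n" "a \<noteq> b"
  shows "cube_face n {a, b} w \<in> cube_faces n 2"
proof -
  have "{a, b} \<subseteq> {..<n}" "card {a, b} = 2" using assms by auto
  then show ?thesis using assms(1) unfolding cube_faces_def by blast
qed

lemma edge_vertex:
  assumes "v \<in> cube_vertices n" "i < n" "j < n" "(a, d) \<in> square_edges v i j"
  shows "a \<in> cube_vertices n" "d \<in> {i, j}" "d < n"
  using assms by (auto simp: square_edges_def)

lemma prism_faces:
  assumes "a \<in> cube_vertices n" "d < n" "k < n" "l < n" "d \<noteq> k" "d \<noteq> l" "k \<noteq> l"
  shows "prism n a d k l \<subseteq> cube_faces n 2"
  using assms by (auto simp: prism_def intro!: square_face)

text \<open>
  Two applications of \<open>commuting_cube\<close>: the first, in directions \<open>d\<close>, \<open>k\<close>, \<open>l\<close>, for each side square,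
  and the second, in directions \<open>i\<close>, \<open>j\<close>, \<open>k\<close>, for the square itself.
\<close>

lemma capped_commuting:
  assumes edges: "\<And>u d. u \<in> cube_vertices n \<Longrightarrow> d < n \<Longrightarrow> cube_face n {d} u \<in> K"
    and present: "\<And>\<sigma>. \<sigma> \<in> cube_faces n 2 \<Longrightarrow> \<omega> \<sigma> \<Longrightarrow> \<sigma> \<in> K"
    and v: "v \<in> cube_vertices n" and ij: "i < n" "j < n" "i \<noteq> j"
    and L: "\<And>a d. (a, d) \<in> square_edges v i j \<Longrightarrow> L (a, d) \<subseteq> {..<n} - {i, j}"
      "\<And>a d l. (a, d) \<in> square_edges v i j \<Longrightarrow> l \<in> L (a, d) \<Longrightarrow> \<omega> (cube_face n {d, l} a)"
    and k: "k < n" "k \<notin> {i, j}" "\<And>a d. (a, d) \<in> square_edges v i j \<Longrightarrow> k \<notin> L (a, d)"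
    and capped: "\<omega> \<in> capped n v i j L k"
  shows "commuting (\<Union>K) v i j"
proof -
  have edge: "path_image (seg u (flip u d)) \<subseteq> \<Union>K" if "u \<in> cube_vertices n" "d < n" for u d
  proof -
    have "path_image (seg u (flip u d)) \<subseteq> cube_face n {d} u"
      using seg_convex_face[of n "{d}" u] that by (simp add: seg_convex_def)
    then show ?thesis using edges[OF that] by blast
  qed
  have face: "commuting (\<Union>K) w a b"
    if "\<omega> (cube_face n {a, b} w)" "w \<in> cube_vertices n" "a < n" "b < n" "a \<noteq> b" for w a b
    using present[OF square_face that(1)] that by (intro commuting_face[of _ n]) auto
  have side: "commuting (\<Union>K) a d k" if e: "(a, d) \<in> square_edges v i j" for a d
  proof -
    obtain l where l: "l \<in> L (a, d)" "\<forall>\<sigma>\<in>prism n a d k l. \<omega> \<sigma>"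
      using capped e by (auto simp: capped_def)
    note a = edge_vertex[OF v ij(1,2) e]
    have l': "l < n" "l \<notin> {i, j}" "l \<noteq> k" using L(1)[OF e] l(1) k(3)[OF e] by auto
    have ne: "d \<noteq> k" "d \<noteq> l" using a(2) k(2) l'(2) by auto
    have pr: "\<omega> (cube_face n {d, l} (flip a k))" "\<omega> (cube_face n {d, k} (flip a l))"
      "\<omega> (cube_face n {k, l} a)" "\<omega> (cube_face n {k, l} (flip a d))"
      using l(2) by (simp_all add: prism_def)
    note vert = a(1) flip_vertex[OF a(1) a(3)] flip_vertex[OF a(1) k(1)] flip_vertex[OF a(1) l'(1)]
    show ?thesis
      using commuting_cube[OF edge a(1) a(3) k(1) l'(1)
          face[OF L(2)[OF e l(1)] vert(1) a(3) l'(1) ne(2)]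
          face[OF pr(3) vert(1) k(1) l'(1) l'(3)[symmetric]]
          face[OF pr(1) vert(3) a(3) l'(1) ne(2)]
          face[OF pr(4) vert(2) k(1) l'(1) l'(3)[symmetric]]
          face[OF pr(2) vert(4) a(3) k(1) ne(1)]] .
  qed
  have edges4: "(v, i) \<in> square_edges v i j" "(v, j) \<in> square_edges v i j"
    "(flip v j, i) \<in> square_edges v i j" "(flip v i, j) \<in> square_edges v i j"
    by (simp_all add: square_edges_def)
  have top: "\<omega> (cube_face n {i, j} (flip v k))" using capped by (simp add: capped_def)
  show ?thesis
    using commuting_cube[OF edge v ij(1,2) k(1) side[OF edges4(1)] side[OF edges4(2)]
        side[OF edges4(3)] side[OF edges4(4)] face[OF top flip_vertex[OF v k(1)] ij]] .
qed

section \<open>Separating the squares used for different directions\<close>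

text \<open>
  The directions outside \<open>i\<close>, \<open>j\<close> in which \<open>\<sigma>\<close> leaves the plane of the square \<open>(i, j)\<close> at \<open>v\<close>. Reading
  off \<open>k\<close> and \<open>l\<close> from a face shows at once that the faces consulted for different \<open>k\<close>, or for
  different \<open>l\<close> at a given edge, are different, so that the corresponding events are independent.
\<close>

definition touched :: "(nat \<Rightarrow> real) \<Rightarrow> nat \<Rightarrow> nat \<Rightarrow> (nat \<Rightarrow> real) set \<Rightarrow> nat set" where
  "touched v i j \<sigma> = {c. \<exists>x\<in>\<sigma>. x c \<noteq> v c} - {i, j}"

lemma touched_face:
  assumes w: "w \<in> cube_vertices n" and v: "v \<in> cube_vertices n" and F: "F \<subseteq> {..<n}"
  shows "touched v i j (cube_face n F w) = (F \<union> {c. w c \<noteq> v c}) - {i, j}"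
proof -
  have "(\<exists>x\<in>cube_face n F w. x c \<noteq> v c) \<longleftrightarrow> c \<in> F \<or> w c \<noteq> v c" for c
  proof
    assume "\<exists>x\<in>cube_face n F w. x c \<noteq> v c"
    then obtain x where x: "x \<in> cube_face n F w" "x c \<noteq> v c" by auto
    show "c \<in> F \<or> w c \<noteq> v c"
      using x v by (cases "c < n") (auto simp: cube_face_def cube_def cube_vertices_def)
  next
    assume "c \<in> F \<or> w c \<noteq> v c"
    moreover have "\<exists>x\<in>cube_face n F w. x c \<noteq> v c" if "c \<in> F" "w c = v c"
    proof
      show "flip w c \<in> cube_face n F w" using that w F by auto
      have "v c = 0 \<or> v c = 1" using v that F by (auto simp: cube_vertices_def)
      then show "flip w c c \<noteq> v c" using that by (auto simp: flip_def)
    qed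
    ultimately show "\<exists>x\<in>cube_face n F w. x c \<noteq> v c" using w by (metis vertex_in_face)
  qed
  then show ?thesis by (simp add: touched_def set_eq_iff)
qed

lemma flip_differs:
  assumes "v \<in> cube_vertices n" "c < n"
  shows "1 - v c \<noteq> v c"
proof -
  have "v c = 0 \<or> v c = 1" using assms by (auto simp: cube_vertices_def)
  then show ?thesis by auto
qed

lemma touched_prism:
  assumes v: "v \<in> cube_vertices n" and ij: "i < n" "j < n" and e: "(a, d) \<in> square_edges v i j"
    and k: "k < n" "k \<notin> {i, j}" and l: "l < n" "l \<notin> {i, j}"
    and \<sigma>: "\<sigma> \<in> prism n a d k l"
  shows "touched v i j \<sigma> = {k, l}"
proof -
  note a = edge_vertex[OF v ij e]
  have same: "a c = v c" if "c \<notin> {i, j}" for c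
    using e that by (auto simp: square_edges_def flip_def)
  have agree: "{c. a c \<noteq> v c} - {i, j} = {}" using same by blast
  have differ: "{c. flip a b c \<noteq> v c} - {i, j} = {b} - {i, j}" if "b < n" for b
  proof -
    have "flip a b c \<noteq> v c \<longleftrightarrow> c = b" if "c \<notin> {i, j}" for c
      using same[OF that] flip_differs[OF a(1) \<open>b < n\<close>] by (cases "c = b") (auto simp: flip_def)
    then show ?thesis by blast
  qed
  have touched: "touched v i j (cube_face n F w) = (F - {i, j}) \<union> ({c. w c \<noteq> v c} - {i, j})"
    if "w \<in> cube_vertices n" "F \<subseteq> {..<n}" for w F
    using touched_face[OF that(1) v that(2)] by (simp only: Un_Diff)
  note vert = flip_vertex[OF a(1) a(3)] flip_vertex[OF a(1) k(1)] flip_vertex[OF a(1) l(1)]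
  have sub: "{d, l} \<subseteq> {..<n}" "{d, k} \<subseteq> {..<n}" "{k, l} \<subseteq> {..<n}" using a k l by auto
  have "touched v i j (cube_face n {d, l} (flip a k)) = {k, l}"
    unfolding touched[OF vert(2) sub(1)] differ[OF k(1)] using a(2) k l by blast
  moreover have "touched v i j (cube_face n {d, k} (flip a l)) = {k, l}"
    unfolding touched[OF vert(3) sub(2)] differ[OF l(1)] using a(2) k l by blast
  moreover have "touched v i j (cube_face n {k, l} a) = {k, l}"
    unfolding touched[OF a(1) sub(3)] agree using k l by blast
  moreover have "touched v i j (cube_face n {k, l} (flip a d)) = {k, l}"
    unfolding touched[OF vert(1) sub(3)] differ[OF a(3)] using a(2) k l by blast
  ultimately show ?thesis using \<sigma> by (auto simp: prism_def)
qed

lemma touched_top: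
  assumes v: "v \<in> cube_vertices n" and ij: "i < n" "j < n" and k: "k < n" "k \<notin> {i, j}"
  shows "touched v i j (cube_face n {i, j} (flip v k)) = {k}"
proof -
  have "{c. flip v k c \<noteq> v c} = {k}"
    using flip_differs[OF v k(1)] by (auto simp: flip_def)
  then show ?thesis
    using touched_face[OF flip_vertex[OF v k(1)] v, of "{i, j}" i j] ij k(2) by auto
qed

lemma card_prism: "card (prism n a d k l) \<le> 4"
  using card_length[of "[cube_face n {d, l} (flip a k), cube_face n {d, k} (flip a l),
     cube_face n {k, l} a, cube_face n {k, l} (flip a d)]"] by (simp add: prism_def)

lemma card_cube_vertices: "card (cube_vertices n) \<le> 2 ^ n"
proof -
  have "inj_on (\<lambda>v. {i. i < n \<and> v i = 1}) (cube_vertices n)"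
  proof (rule inj_onI)
    fix v w assume v: "v \<in> cube_vertices n" and w: "w \<in> cube_vertices n"
      and eq: "{i. i < n \<and> v i = 1} = {i. i < n \<and> w i = 1}"
    have "v i = w i" for i
    proof (cases "i < n")
      case True
      then have "v i = 1 \<longleftrightarrow> w i = 1" using eq by blast
      moreover have "v i = 0 \<or> v i = 1" "w i = 0 \<or> w i = 1"
        using v w True by (auto simp: cube_vertices_def)
      ultimately show ?thesis by auto
    qed (use v w in \<open>auto simp: cube_vertices_def\<close>)
    then show "v = w" by auto
  qed
  then have "card (cube_vertices n) \<le> card (Pow {..<n})"
    by (rule card_inj_on_le) auto
  then show ?thesis by (simp add: card_Pow)
qed

lemma card_subsets_le: "card {L. L \<subseteq> {..<n} \<and> card L = m} \<le> n ^ m"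
proof (cases "m \<le> n")
  case True
  then show ?thesis using n_subsets[of "{..<n}" m] binomial_le_pow[of m n] by simp
next
  case False
  have "card L \<le> n" if "L \<subseteq> {..<n}" for L
    using card_mono[OF _ that] by simp
  then have none: "{L. L \<subseteq> {..<n} \<and> card L = m} = {}" using False by auto
  show ?thesis unfolding none by simp
qed

section \<open>Independence in finite product distributions\<close>

definition determined_by :: "'a set \<Rightarrow> ('a \<Rightarrow> 'b) set \<Rightarrow> bool" where
  "determined_by X E \<longleftrightarrow> (\<forall>f g. (\<forall>x\<in>X. f x = g x) \<longrightarrow> f \<in> E \<longleftrightarrow> g \<in> E)"

lemma determined_byD: "determined_by X E \<Longrightarrow> (\<And>x. x \<in> X \<Longrightarrow> f x = g x) \<Longrightarrow> f \<in> E \<longleftrightarrow> g \<in> E"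
  by (auto simp: determined_by_def)

lemma determined_by_mono: "determined_by X E \<Longrightarrow> X \<subseteq> Y \<Longrightarrow> determined_by Y E"
  by (simp add: determined_by_def) (meson subsetD)

lemma determined_by_INT: "(\<And>k. k \<in> L \<Longrightarrow> determined_by X (E k)) \<Longrightarrow> determined_by X (\<Inter>k\<in>L. E k)"
  unfolding determined_by_def by (simp, metis)

lemma prob_pair_pmf_Times:
  "measure_pmf.prob (pair_pmf M N) (A \<times> B) = measure_pmf.prob M A * measure_pmf.prob N B"
proof -
  have "measure_pmf.prob (pair_pmf M N) (A \<times> B) =
      measure_pmf.prob (pair_pmf M N) ((A \<inter> set_pmf M) \<times> (B \<inter> set_pmf N))"
    by (rule measure_prob_cong_0) (auto simp: pmf_eq_0_set_pmf)
  also have "\<dots> = measure_pmf.prob M (A \<inter> set_pmf M) * measure_pmf.prob N (B \<inter> set_pmf N)"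
    by (rule measure_pmf_prob_product) auto
  finally show ?thesis by (simp add: measure_Int_set_pmf)
qed

text \<open>
  A product distribution on \<open>I\<close> is the product of its restrictions to \<open>X\<close> and to \<open>I - X\<close>, and
  the events \<open>E\<close> and \<open>F\<close> depend on one of these factors each.
\<close>

lemma prob_Pi_pmf_Int:
  assumes I: "finite I" and X: "X \<subseteq> I" "determined_by X E" and Y: "Y \<subseteq> I" "determined_by Y F"
    and "X \<inter> Y = {}"
  shows "measure_pmf.prob (Pi_pmf I d p) (E \<inter> F) =
    measure_pmf.prob (Pi_pmf I d p) E * measure_pmf.prob (Pi_pmf I d p) F"
proof -
  have split: "measure_pmf.prob (Pi_pmf I d p) (E' \<inter> F') =
      measure_pmf.prob (Pi_pmf X d p) E' * measure_pmf.prob (Pi_pmf (I - X) d p) F'"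
    if E': "determined_by X E'" and F': "determined_by (I - X) F'" for E' F'
  proof -
    let ?h = "\<lambda>(f, g) x. if x \<in> X then f x else g x"
    have "Pi_pmf I d p = map_pmf ?h (pair_pmf (Pi_pmf X d p) (Pi_pmf (I - X) d p))"
      using Pi_pmf_union[of X "I - X" d p] I X(1) by (simp add: finite_subset Un_absorb1)
    moreover have "?h -` (E' \<inter> F') = E' \<times> F'"
    proof -
      have "(?h (f, g) \<in> E') = (f \<in> E')" for f g
        by (rule determined_byD[OF E']) simp
      moreover have "(?h (f, g) \<in> F') = (g \<in> F')" for f g
        by (rule determined_byD[OF F']) simp
      ultimately show ?thesis by auto
    qed
    ultimately show ?thesis by (simp add: prob_pair_pmf_Times)
  qed
  have F: "determined_by (I - X) F"
    using Y \<open>X \<inter> Y = {}\<close> by (auto intro: determined_by_mono)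
  have U: "determined_by Z UNIV" for Z :: "'a set" by (auto simp: determined_by_def)
  show ?thesis
    using split[OF X(2) F] split[OF X(2) U] split[OF U F] by simp
qed

lemma prob_Pi_pmf_INT:
  assumes I: "finite I" and "finite L"
    and T: "\<And>k. k \<in> L \<Longrightarrow> T k \<subseteq> I" "\<And>k. k \<in> L \<Longrightarrow> determined_by (T k) (E k)"
    and "disjoint_family_on T L"
  shows "measure_pmf.prob (Pi_pmf I d p) (\<Inter>k\<in>L. E k) = (\<Prod>k\<in>L. measure_pmf.prob (Pi_pmf I d p) (E k))"
  using \<open>finite L\<close> T \<open>disjoint_family_on T L\<close>
proof (induction L rule: finite_induct)
  case (insert k L)
  have "measure_pmf.prob (Pi_pmf I d p) (E k \<inter> (\<Inter>l\<in>L. E l)) =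
      measure_pmf.prob (Pi_pmf I d p) (E k) * measure_pmf.prob (Pi_pmf I d p) (\<Inter>l\<in>L. E l)"
  proof (rule prob_Pi_pmf_Int[OF I])
    show "determined_by (\<Union>l\<in>L. T l) (\<Inter>l\<in>L. E l)"
      by (rule determined_by_INT) (use insert.prems(2) in \<open>blast intro: determined_by_mono\<close>)
    show "T k \<inter> (\<Union>l\<in>L. T l) = {}"
      using insert.prems(3) insert.hyps(2) by (auto simp: disjoint_family_on_def)
  qed (use insert in auto)
  moreover have "measure_pmf.prob (Pi_pmf I d p) (\<Inter>l\<in>L. E l) = (\<Prod>l\<in>L. measure_pmf.prob (Pi_pmf I d p) (E l))"
    by (rule insert.IH) (use insert.prems in \<open>auto simp: disjoint_family_on_def\<close>)
  ultimately show ?case using insert.hyps by simp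
qed simp

lemma prob_Pi_pmf_present:
  assumes I: "finite I" and "x \<in> I" and p: "0 \<le> p" "p \<le> 1"
  shows "measure_pmf.prob (Pi_pmf I False (\<lambda>_. bernoulli_pmf p)) {\<omega>. \<omega> x = b} = (if b then p else 1 - p)"
proof -
  have "map_pmf (\<lambda>\<omega>. \<omega> x) (Pi_pmf I False (\<lambda>_. bernoulli_pmf p)) = bernoulli_pmf p"
    using assms by (simp add: Pi_pmf_component)
  then have "measure_pmf.prob (Pi_pmf I False (\<lambda>_. bernoulli_pmf p)) ((\<lambda>\<omega>. \<omega> x) -` {b}) = measure_pmf.prob (bernoulli_pmf p) {b}"
    by (metis measure_map_pmf)
  then show ?thesis using p by (auto simp: vimage_def measure_pmf_single)
qed

lemma prob_Pi_pmf_all: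
  assumes I: "finite I" and T: "T \<subseteq> I" and p: "0 \<le> p" "p \<le> 1"
  shows "measure_pmf.prob (Pi_pmf I False (\<lambda>_. bernoulli_pmf p)) {\<omega>. \<forall>x\<in>T. \<omega> x = b}
    = (if b then p else 1 - p) ^ card T"
proof -
  have fin: "finite T" using I T finite_subset by blast
  have "{\<omega>. \<forall>x\<in>T. \<omega> x = b} = (\<Inter>x\<in>T. {\<omega>. \<omega> x = b})" by auto
  then have "measure_pmf.prob (Pi_pmf I False (\<lambda>_. bernoulli_pmf p)) {\<omega>. \<forall>x\<in>T. \<omega> x = b} =
     (\<Prod>x\<in>T. measure_pmf.prob (Pi_pmf I False (\<lambda>_. bernoulli_pmf p)) {\<omega>. \<omega> x = b})"
    by (simp only:) (rule prob_Pi_pmf_INT[OF I fin, of "\<lambda>x. {x}"],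
      use T in \<open>auto simp: determined_by_def disjoint_family_on_def\<close>)
  also have "\<dots> = (\<Prod>x\<in>T. if b then p else 1 - p)"
    by (intro prod.cong refl prob_Pi_pmf_present) (use I T p in auto)
  finally show ?thesis by simp
qed

text \<open>
  The exponential factor is \<open>(2 r)^n\<close> with \<open>2 r < 1\<close>. Since \<open>r = 0\<close> is possible, \<open>r\<close> is replaced by
  a positive upper bound, which can be raised to the power \<open>- b\<close>.
\<close>

lemma power_poly_tendsto_0:
  fixes r :: real
  assumes "0 \<le> r" "r < 1/2"
  shows "(\<lambda>n. 2 ^ n * real n ^ a * r ^ (n - b)) \<longlonglongrightarrow> 0"
proof -
  \<comment> \<open>\<open>1/4\<close> stands for any number strictly between \<open>0\<close> and \<open>1/2\<close>\<close>
  define s where "s = max r (1/4)"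
  have s: "0 < s" "s < 1/2" "r \<le> s" using assms by (auto simp: s_def)
  have "(\<lambda>n. real n ^ a * (2 * s) ^ n * (1 / s) ^ b) \<longlonglongrightarrow> 0"
    using s by real_asymp
  then show ?thesis
  proof (rule Lim_null_comparison[rotated])
    show "\<forall>\<^sub>F n in sequentially. norm (2 ^ n * real n ^ a * r ^ (n - b)) \<le> real n ^ a * (2 * s) ^ n * (1 / s) ^ b"
      using eventually_ge_at_top[of b]
    proof eventually_elim
      case (elim n)
      have "r ^ (n - b) \<le> s ^ (n - b)" using assms s by (intro power_mono)
      also have "\<dots> = s ^ n * (1 / s) ^ b" using s elim by (simp add: power_diff power_one_over field_simps)
      finally have "2 ^ n * real n ^ a * r ^ (n - b) \<le> 2 ^ n * real n ^ a * (s ^ n * (1 / s) ^ b)"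
        by (intro mult_left_mono) auto
      then show ?case using assms by (simp add: power_mult_distrib mult_ac)
    qed
  qed
qed

section \<open>Union bounds for the random complex\<close>

locale random_squares =
  fixes n m :: nat and p :: real
  assumes p: "0 \<le> p" "p \<le> 1"
begin

abbreviation "\<Omega> \<equiv> Pi_pmf (cube_faces n 2) False (\<lambda>_. bernoulli_pmf p)"

text \<open>
  An upper bound for the probability that a given direction fails to cap a given square: the
  parallel square is absent, or for one of the four edges all \<open>m\<close> auxiliary directions fail.
\<close>

definition "q = (1 - p) + 4 * (1 - p ^ 4) ^ m"

text \<open>
  No square at the edge \<open>(a, d)\<close> has its other direction outside \<open>M\<close>. An edge that lies in at most
  \<open>m\<close> squares has this property for some set \<open>M\<close> of size \<open>m\<close>.
\<close>

definition bare :: "(nat \<Rightarrow> real) \<Rightarrow> nat \<Rightarrow> nat set \<Rightarrow> ((nat \<Rightarrow> real) set \<Rightarrow> bool) set" where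
  "bare a d M = {\<omega>. \<forall>l\<in>{..<n} - M - {d}. \<not> \<omega> (cube_face n {d, l} a)}"

text \<open>
  Only directions outside all the sets \<open>L e\<close> are tried, so that \<open>k\<close> can be recovered from the
  directions \<open>{k, l}\<close> that a face touches.
\<close>

definition uncapped :: "(nat \<Rightarrow> real) \<Rightarrow> nat \<Rightarrow> nat \<Rightarrow> ((nat \<Rightarrow> real) \<times> nat \<Rightarrow> nat set) \<Rightarrow> ((nat \<Rightarrow> real) set \<Rightarrow> bool) set" where
  "uncapped v i j L = (\<Inter>k\<in>{..<n} - {i, j} - \<Union>(L ` square_edges v i j). - capped n v i j L k)"

lemma prob_bare:
  assumes a: "a \<in> cube_vertices n" and d: "d < n" and M: "card M = m" "M \<subseteq> {..<n}"
  shows "measure_pmf.prob \<Omega> (bare a d M) \<le> (1 - p) ^ (n - (m + 1))"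
proof -
  let ?ls = "{..<n} - M - {d}"
  let ?T = "(\<lambda>l. cube_face n {d, l} a) ` ?ls"
  \<comment> \<open>a square at the edge determines its other direction, the only one besides \<open>d\<close> that it touches\<close>
  have "inj_on (\<lambda>l. cube_face n {d, l} a) ?ls"
  proof (rule inj_on_inverseI)
    fix l assume "l \<in> ?ls"
    then show "the_elem (touched a d d (cube_face n {d, l} a)) = l"
      using a d by (simp add: touched_face insert_Diff_if)
  qed
  then have card: "card ?T = card ?ls" by (rule card_image)
  have fM: "finite M" using M finite_subset by blast
  have "n - m - 1 \<le> card ?ls"
    using diff_card_le_card_Diff[of "{d}" "{..<n} - M"] diff_card_le_card_Diff[of M "{..<n}"] fM M by simp
  then have "(1 - p) ^ card ?T \<le> (1 - p) ^ (n - (m + 1))"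
    unfolding card using p by (intro power_decreasing) auto
  moreover have "bare a d M = {\<omega>. \<forall>\<sigma>\<in>?T. \<omega> \<sigma> = False}" by (auto simp: bare_def)
  moreover have "?T \<subseteq> cube_faces n 2" using a d by (auto intro!: square_face)
  ultimately show ?thesis
    using prob_Pi_pmf_all[OF finite_cube_faces _ p, of ?T n 2 False] by simp
qed

lemma prob_no_prism:
  assumes v: "v \<in> cube_vertices n" and ij: "i < n" "j < n" and e: "(a, d) \<in> square_edges v i j"
    and k: "k < n" "k \<notin> {i, j}" and L: "L \<subseteq> {..<n} - {i, j}" "card L = m" "k \<notin> L"
  shows "measure_pmf.prob \<Omega> (\<Inter>l\<in>L. - {\<omega>. \<forall>\<sigma>\<in>prism n a d k l. \<omega> \<sigma>}) \<le> (1 - p ^ 4) ^ m"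
proof -
  note a = edge_vertex[OF v ij e]
  have fL: "finite L" using L finite_subset by blast
  have sub: "prism n a d k l \<subseteq> cube_faces n 2" if "l \<in> L" for l
    by (rule prism_faces) (use a k L that in auto)
  have "measure_pmf.prob \<Omega> (\<Inter>l\<in>L. - {\<omega>. \<forall>\<sigma>\<in>prism n a d k l. \<omega> \<sigma>})
      = (\<Prod>l\<in>L. measure_pmf.prob \<Omega> (- {\<omega>. \<forall>\<sigma>\<in>prism n a d k l. \<omega> \<sigma>}))"
  proof (rule prob_Pi_pmf_INT[OF finite_cube_faces fL])
    show "disjoint_family_on (prism n a d k) L"
      unfolding disjoint_family_on_def
    proof (intro ballI impI)
      fix l l' assume l: "l \<in> L" "l' \<in> L" "l \<noteq> l'"
      have "touched v i j \<sigma> = {k, l}" if "\<sigma> \<in> prism n a d k l" "l \<in> L" for \<sigma> l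
        by (rule touched_prism[OF v ij e k _ _ that(1)]) (use L that in auto)
      then show "prism n a d k l \<inter> prism n a d k l' = {}"
        using l by (metis disjoint_iff doubleton_eq_iff)
    qed
  qed (use sub in \<open>auto simp: determined_by_def\<close>)
  also have "\<dots> \<le> (\<Prod>l\<in>L. 1 - p ^ 4)"
  proof (rule prod_mono)
    fix l assume l: "l \<in> L"
    have "measure_pmf.prob \<Omega> {\<omega>. \<forall>\<sigma>\<in>prism n a d k l. \<omega> \<sigma>} = p ^ card (prism n a d k l)"
      using prob_Pi_pmf_all[OF finite_cube_faces sub[OF l] p, of True] by simp
    moreover have "p ^ 4 \<le> p ^ card (prism n a d k l)"
      using p card_prism by (intro power_decreasing) auto
    ultimately show "0 \<le> measure_pmf.prob \<Omega> (- {\<omega>. \<forall>\<sigma>\<in>prism n a d k l. \<omega> \<sigma>}) \<and>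
        measure_pmf.prob \<Omega> (- {\<omega>. \<forall>\<sigma>\<in>prism n a d k l. \<omega> \<sigma>}) \<le> 1 - p ^ 4"
      using measure_pmf.prob_compl[of "{\<omega>. \<forall>\<sigma>\<in>prism n a d k l. \<omega> \<sigma>}" \<Omega>]
      using p by (simp add: Compl_eq_Diff_UNIV power_le_one)
  qed
  finally show ?thesis using L by simp
qed

text \<open>
  The sum over the absent top and the four edges is a union bound; independence enters only for
  the \<open>m\<close> auxiliary directions of a single edge.
\<close>

lemma prob_not_capped:
  assumes v: "v \<in> cube_vertices n" and ij: "i < n" "j < n" "i \<noteq> j"
    and k: "k < n" "k \<notin> {i, j}"
    and L: "\<And>e. e \<in> square_edges v i j \<Longrightarrow> L e \<subseteq> {..<n} - {i, j} \<and> card (L e) = m \<and> k \<notin> L e"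
  shows "measure_pmf.prob \<Omega> (- capped n v i j L k) \<le> q"
proof -
  let ?top = "cube_face n {i, j} (flip v k)"
  let ?N = "\<lambda>e. \<Inter>l\<in>L e. - {\<omega>. \<forall>\<sigma>\<in>prism n (fst e) (snd e) k l. \<omega> \<sigma>}"
  have "- capped n v i j L k \<subseteq> {\<omega>. \<omega> ?top = False} \<union> (\<Union>e\<in>square_edges v i j. ?N e)"
    by (auto simp: capped_def) force
  then have "measure_pmf.prob \<Omega> (- capped n v i j L k) \<le> measure_pmf.prob \<Omega> ({\<omega>. \<omega> ?top = False} \<union> (\<Union>e\<in>square_edges v i j. ?N e))"
    by (intro measure_pmf.finite_measure_mono) auto
  also have "\<dots> \<le> measure_pmf.prob \<Omega> {\<omega>. \<omega> ?top = False} + measure_pmf.prob \<Omega> (\<Union>e\<in>square_edges v i j. ?N e)"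
    by (rule measure_Un_le) auto
  also have "\<dots> \<le> (1 - p) + 4 * (1 - p ^ 4) ^ m"
  proof (rule add_mono)
    have "?top \<in> cube_faces n 2" by (rule square_face) (use v ij k in auto)
    then show "measure_pmf.prob \<Omega> {\<omega>. \<omega> ?top = False} \<le> 1 - p"
      using prob_Pi_pmf_present[OF finite_cube_faces _ p, of ?top n 2 False] by simp
    have "measure_pmf.prob \<Omega> (\<Union>e\<in>square_edges v i j. ?N e) \<le> (\<Sum>e\<in>square_edges v i j. measure_pmf.prob \<Omega> (?N e))"
      by (rule measure_pmf.finite_measure_subadditive_finite) auto
    also have "\<dots> \<le> of_nat (card (square_edges v i j)) * (1 - p ^ 4) ^ m"
    proof (rule sum_bounded_above)
      fix e assume "e \<in> square_edges v i j"
      then show "measure_pmf.prob \<Omega> (?N e) \<le> (1 - p ^ 4) ^ m"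
        using L by (intro prob_no_prism[OF v ij(1,2) _ k]) auto
    qed
    also have "\<dots> \<le> 4 * (1 - p ^ 4) ^ m"
      using card_square_edges[of v i j] p by (intro mult_right_mono) (auto simp: power_le_one)
    finally show "measure_pmf.prob \<Omega> (\<Union>e\<in>square_edges v i j. ?N e) \<le> 4 * (1 - p ^ 4) ^ m" .
  qed
  finally show ?thesis by (simp add: q_def)
qed

text \<open>
  The event for \<open>k\<close> is determined by the squares that touch exactly \<open>k\<close> once the directions in the
  sets \<open>L e\<close> are disregarded. These sets of squares are disjoint, so the failures of the at least
  \<open>n - (4 m + 2)\<close> directions multiply.
\<close>

lemma prob_uncapped:
  assumes v: "v \<in> cube_vertices n" and ij: "i < n" "j < n" "i \<noteq> j"
    and L: "\<And>e. e \<in> square_edges v i j \<Longrightarrow> L e \<subseteq> {..<n} - {i, j} \<and> card (L e) = m"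
    and q: "q \<le> 1"
  shows "measure_pmf.prob \<Omega> (uncapped v i j L) \<le> q ^ (n - (4 * m + 2))"
proof -
  define M where "M = \<Union>(L ` square_edges v i j)"
  define ks where "ks = {..<n} - {i, j} - M"
  define T where "T = (\<lambda>k. {\<sigma> \<in> cube_faces n 2. touched v i j \<sigma> - M = {k}})"
  have q0: "0 \<le> q" using p by (simp add: q_def power_le_one)
  have M: "L e \<subseteq> M" if "e \<in> square_edges v i j" for e using that by (auto simp: M_def)
  have fM: "finite M" unfolding M_def using L finite_subset by fastforce
  have "card M \<le> (\<Sum>e\<in>square_edges v i j. card (L e))"
    unfolding M_def by (rule card_UN_le) simp
  also have "\<dots> = card (square_edges v i j) * m" using L by simp
  also have "\<dots> \<le> 4 * m" using card_square_edges by simp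
  finally have "card M \<le> 4 * m" .
  moreover have "card ks \<ge> card ({..<n} - {i, j}) - card M" "card ({..<n} - {i, j}) \<ge> n - card {i, j}"
    unfolding ks_def using diff_card_le_card_Diff[OF fM] diff_card_le_card_Diff[of "{i, j}" "{..<n}"] by auto
  moreover have "card {i, j} \<le> 2" by (simp add: card_insert_if)
  ultimately have card: "n - (4 * m + 2) \<le> card ks" by linarith
  have "measure_pmf.prob \<Omega> (uncapped v i j L) = (\<Prod>k\<in>ks. measure_pmf.prob \<Omega> (- capped n v i j L k))"
    unfolding uncapped_def M_def[symmetric] ks_def[symmetric]
  proof (rule prob_Pi_pmf_INT[OF finite_cube_faces])
    show "disjoint_family_on T ks" by (auto simp: disjoint_family_on_def T_def)
    fix k assume "k \<in> ks"
    then have k: "k < n" "k \<notin> {i, j}" "k \<notin> M" by (auto simp: ks_def)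
    show "T k \<subseteq> cube_faces n 2" by (auto simp: T_def)
    have top: "cube_face n {i, j} (flip v k) \<in> T k"
      using touched_top[OF v ij(1,2) k(1,2)] square_face[of "flip v k" n i j] v ij k by (auto simp: T_def)
    have side: "prism n a d k l \<subseteq> T k" if e: "(a, d) \<in> square_edges v i j" and l: "l \<in> L (a, d)" for a d l
    proof -
      note a = edge_vertex[OF v ij(1,2) e]
      have l': "l < n" "l \<notin> {i, j}" "l \<in> M" using L[OF e] M[OF e] l by auto
      have "prism n a d k l \<subseteq> cube_faces n 2" by (rule prism_faces) (use a k l' in auto)
      moreover have "touched v i j \<sigma> - M = {k}" if "\<sigma> \<in> prism n a d k l" for \<sigma>
        using touched_prism[OF v ij(1,2) e k(1,2) l'(1,2) that] k l' by auto
      ultimately show ?thesis by (auto simp: T_def)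
    qed
    show "determined_by (T k) (- capped n v i j L k)"
      unfolding determined_by_def
    proof (intro allI impI)
      fix f g :: "(nat \<Rightarrow> real) set \<Rightarrow> bool" assume fg: "\<forall>\<sigma>\<in>T k. f \<sigma> = g \<sigma>"
      have "(\<forall>\<sigma>\<in>prism n a d k l. f \<sigma>) = (\<forall>\<sigma>\<in>prism n a d k l. g \<sigma>)"
        if "(a, d) \<in> square_edges v i j" "l \<in> L (a, d)" for a d l
        using fg side[OF that] by (meson subsetD)
      then have "(case e of (a, d) \<Rightarrow> \<exists>l\<in>L (a, d). \<forall>\<sigma>\<in>prism n a d k l. f \<sigma>) =
          (case e of (a, d) \<Rightarrow> \<exists>l\<in>L (a, d). \<forall>\<sigma>\<in>prism n a d k l. g \<sigma>)"
        if "e \<in> square_edges v i j" for e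
        using that by (cases e) (simp cong: bex_cong)
      then have "(\<forall>(a, d)\<in>square_edges v i j. \<exists>l\<in>L (a, d). \<forall>\<sigma>\<in>prism n a d k l. f \<sigma>) =
          (\<forall>(a, d)\<in>square_edges v i j. \<exists>l\<in>L (a, d). \<forall>\<sigma>\<in>prism n a d k l. g \<sigma>)"
        by (rule ball_cong[OF refl])
      moreover have "f (cube_face n {i, j} (flip v k)) = g (cube_face n {i, j} (flip v k))"
        using fg top by blast
      ultimately show "f \<in> - capped n v i j L k \<longleftrightarrow> g \<in> - capped n v i j L k"
        unfolding capped_def Compl_iff mem_Collect_eq by (simp only:)
    qed
  qed (simp add: ks_def)
  also have "\<dots> \<le> (\<Prod>k\<in>ks. q)"
  proof (rule prod_mono)
    fix k assume "k \<in> ks"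
    then have k: "k < n" "k \<notin> {i, j}" "k \<notin> M" by (auto simp: ks_def)
    have "L e \<subseteq> {..<n} - {i, j} \<and> card (L e) = m \<and> k \<notin> L e" if "e \<in> square_edges v i j" for e
      using L[OF that] M[OF that] k(3) by blast
    then have "measure_pmf.prob \<Omega> (- capped n v i j L k) \<le> q"
      by (rule prob_not_capped[OF v ij k(1,2)])
    then show "0 \<le> measure_pmf.prob \<Omega> (- capped n v i j L k) \<and> measure_pmf.prob \<Omega> (- capped n v i j L k) \<le> q"
      by simp
  qed
  also have "\<dots> \<le> q ^ (n - (4 * m + 2))"
    using card q q0 by (simp add: power_decreasing)
  finally show ?thesis .
qed

text \<open>
  The sets \<open>L e\<close> used for a complex depend on it, namely on the squares present at the four edges. The
  union over all possible choices costs only a factor polynomial in \<open>n\<close>, because \<open>m\<close> is constant.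
\<close>

definition "choices v i j = (square_edges v i j \<rightarrow>\<^sub>E {L. L \<subseteq> {..<n} - {i, j} \<and> card L = m})"

definition "bad_edge = (\<Union>(a, d, M)\<in>cube_vertices n \<times> {..<n} \<times> {M. M \<subseteq> {..<n} \<and> card M = m}. bare a d M)"

definition "bad_square =
  (\<Union>(v, i, j)\<in>cube_vertices n \<times> {(i, j). i < n \<and> j < n \<and> i \<noteq> j}. \<Union>L\<in>choices v i j. uncapped v i j L)"

lemma finite_subsets [simp]: "finite {M. M \<subseteq> {..<n} \<and> card M = m}"
  by (rule finite_subset[of _ "Pow {..<n}"]) auto

lemma prob_bad_edge:
  "measure_pmf.prob \<Omega> bad_edge \<le> 2 ^ n * real n ^ (m + 1) * (1 - p) ^ (n - (m + 1))"
proof -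
  let ?I = "cube_vertices n \<times> {..<n} \<times> {M. M \<subseteq> {..<n} \<and> card M = m}"
  have fin: "finite ?I" using finite_cube_vertices by auto
  have "card ?I \<le> 2 ^ n * (n * n ^ m)"
    unfolding card_cartesian_product card_lessThan
    by (intro mult_mono card_cube_vertices card_subsets_le) auto
  then have card: "real (card ?I) \<le> 2 ^ n * real n ^ (m + 1)"
    by (metis (mono_tags, lifting) Suc_eq_plus1 of_nat_mono of_nat_mult of_nat_numeral of_nat_power power_Suc)
  have "measure_pmf.prob \<Omega> bad_edge \<le> (\<Sum>(a, d, M)\<in>?I. measure_pmf.prob \<Omega> (bare a d M))"
    unfolding bad_edge_def case_prod_unfold
    by (rule measure_pmf.finite_measure_subadditive_finite[OF fin]) auto
  also have "\<dots> \<le> of_nat (card ?I) * (1 - p) ^ (n - (m + 1))"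
  proof (rule sum_bounded_above)
    fix z assume z: "z \<in> ?I"
    show "(case z of (a, d, M) \<Rightarrow> measure_pmf.prob \<Omega> (bare a d M)) \<le> (1 - p) ^ (n - (m + 1))"
      using prob_bare[of "fst z" "fst (snd z)" "snd (snd z)"] z
      by (simp add: case_prod_unfold mem_Times_iff)
  qed
  also have "\<dots> \<le> 2 ^ n * real n ^ (m + 1) * (1 - p) ^ (n - (m + 1))"
    using card p by (intro mult_right_mono) auto
  finally show ?thesis .
qed

lemma card_choices: "n > 0 \<Longrightarrow> card (choices v i j) \<le> n ^ (4 * m)"
proof -
  assume n: "n > 0"
  have "card {L. L \<subseteq> {..<n} - {i, j} \<and> card L = m} \<le> card {L. L \<subseteq> {..<n} \<and> card L = m}"
    by (rule card_mono) auto
  also have "\<dots> \<le> n ^ m" by (rule card_subsets_le)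
  finally have "card (choices v i j) \<le> (n ^ m) ^ card (square_edges v i j)"
    unfolding choices_def by (subst card_PiE) (auto intro: power_mono)
  also have "\<dots> \<le> (n ^ m) ^ 4"
    using card_square_edges n by (intro power_increasing) auto
  finally show ?thesis by (simp add: power_mult[symmetric] mult.commute)
qed

lemma finite_choices [simp]: "finite (choices v i j)"
  unfolding choices_def by (intro finite_PiE) (auto intro: finite_subset[OF _ finite_subsets])

lemma prob_bad_square:
  assumes q: "q \<le> 1" and n: "n > 0"
  shows "measure_pmf.prob \<Omega> bad_square \<le> 2 ^ n * real n ^ (4 * m + 2) * q ^ (n - (4 * m + 2))"
proof -
  let ?P = "{(i, j). i < n \<and> j < n \<and> i \<noteq> j}"
  let ?I = "cube_vertices n \<times> ?P"
  let ?b = "q ^ (n - (4 * m + 2))"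
  have q0: "0 \<le> q" using p by (simp add: q_def power_le_one)
  have P: "?P \<subseteq> {..<n} \<times> {..<n}" by auto
  then have fP: "finite ?P" by (rule finite_subset) auto
  have fin: "finite ?I" using finite_cube_vertices fP by auto
  have "card ?P \<le> n * n" using card_mono[OF _ P] by simp
  then have "card ?I \<le> 2 ^ n * (n * n)"
    unfolding card_cartesian_product by (intro mult_mono card_cube_vertices) auto
  then have "real (card ?I) \<le> real (2 ^ n * (n * n))" by (rule of_nat_mono)
  then have card: "real (card ?I) \<le> 2 ^ n * real n ^ 2" by (simp add: power2_eq_square)
  have one: "measure_pmf.prob \<Omega> (\<Union>L\<in>choices v i j. uncapped v i j L) \<le> real n ^ (4 * m) * ?b"
    if v: "v \<in> cube_vertices n" and ij: "i < n" "j < n" "i \<noteq> j" for v i j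
  proof -
    have "measure_pmf.prob \<Omega> (\<Union>L\<in>choices v i j. uncapped v i j L) \<le> (\<Sum>L\<in>choices v i j. measure_pmf.prob \<Omega> (uncapped v i j L))"
      by (rule measure_pmf.finite_measure_subadditive_finite) auto
    also have "\<dots> \<le> of_nat (card (choices v i j)) * ?b"
    proof (rule sum_bounded_above)
      fix L assume L: "L \<in> choices v i j"
      show "measure_pmf.prob \<Omega> (uncapped v i j L) \<le> ?b"
        by (rule prob_uncapped[OF v ij _ q]) (use L in \<open>auto simp: choices_def\<close>)
    qed
    also have "\<dots> \<le> real n ^ (4 * m) * ?b"
      using of_nat_mono[OF card_choices[OF n, of v i j], where 'a = real] q0
      by (intro mult_right_mono) auto
    finally show ?thesis .
  qed
  have "measure_pmf.prob \<Omega> bad_square \<le> (\<Sum>(v, i, j)\<in>?I. measure_pmf.prob \<Omega> (\<Union>L\<in>choices v i j. uncapped v i j L))"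
    unfolding bad_square_def case_prod_unfold
    by (rule measure_pmf.finite_measure_subadditive_finite) (use fin in \<open>auto simp: case_prod_unfold\<close>)
  also have "\<dots> \<le> of_nat (card ?I) * (real n ^ (4 * m) * ?b)"
  proof (rule sum_bounded_above)
    fix z assume z: "z \<in> ?I"
    show "(case z of (v, i, j) \<Rightarrow> measure_pmf.prob \<Omega> (\<Union>L\<in>choices v i j. uncapped v i j L)) \<le> real n ^ (4 * m) * ?b"
      using one[of "fst z" "fst (snd z)" "snd (snd z)"] z
      by (simp add: case_prod_unfold mem_Times_iff)
  qed
  also have "\<dots> \<le> (2 ^ n * real n ^ 2) * (real n ^ (4 * m) * ?b)"
    using card q0 by (intro mult_right_mono) auto
  also have "\<dots> = 2 ^ n * real n ^ (4 * m + 2) * ?b"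
    by (simp add: power_add power2_eq_square mult_ac)
  finally show ?thesis .
qed

text \<open>
  Outside \<open>bad_edge\<close> every edge lies in more than \<open>m\<close> squares of the complex. Of these at most one has
  its other direction in \<open>{i, j}\<close>, so \<open>m\<close> auxiliary directions are left for each edge of the
  square \<open>(i, j)\<close>. Outside \<open>bad_square\<close> some direction then caps the square.
\<close>

lemma good_trivial:
  assumes good: "\<omega> \<notin> bad_edge" "\<omega> \<notin> bad_square" and mn: "m \<le> n"
  defines "K \<equiv> cube_faces n 0 \<union> cube_faces n 1 \<union> {\<sigma> \<in> cube_faces n 2. \<omega> \<sigma>}"
  assumes x: "x \<in> \<Union>K"
  shows "trivial_group (fundamental_group (\<Union>K) x)"
proof -
  have edges: "cube_face n {d} v \<in> K" if "v \<in> cube_vertices n" "d < n" for v d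
  proof -
    have "cube_face n {d} v \<in> cube_faces n 1"
      unfolding cube_faces_def using that by (auto intro!: exI[of _ "{d}"])
    then show ?thesis by (simp add: K_def)
  qed
  have square: "commuting (\<Union>K) v i j" if v: "v \<in> cube_vertices n" and ij: "i < n" "j < n" "i \<noteq> j" for v i j
  proof -
    have "\<exists>L. L \<subseteq> {..<n} - {i, j} \<and> card L = m \<and> (\<forall>l\<in>L. \<omega> (cube_face n {d, l} a))"
      if e: "(a, d) \<in> square_edges v i j" for a d
    proof -
      note a = edge_vertex[OF v ij(1,2) e]
      define G where "G = {l. l < n \<and> l \<noteq> d \<and> \<omega> (cube_face n {d, l} a)}"
      have G: "finite G" "G \<subseteq> {..<n}" "G \<subseteq> {..<n} - {d}" by (auto simp: G_def)
      have "m < card G"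
      proof (rule ccontr)
        assume "\<not> m < card G"
        then obtain M where M: "G \<subseteq> M" "M \<subseteq> {..<n}" "card M = m"
          using exists_subset_between[of G m "{..<n}"] G mn by auto
        have "\<omega> \<in> bare a d M" using M by (auto simp: bare_def G_def)
        then show False using good(1) a M unfolding bad_edge_def by blast
      qed
      moreover have "G - {i, j} = G - ({i, j} - {d})" using G by auto
      moreover have "card ({i, j} - {d}) \<le> 1" using a(2) ij by auto
      ultimately have "m \<le> card (G - {i, j})"
        using diff_card_le_card_Diff[of "{i, j} - {d}" G] by auto
      then obtain L where "L \<subseteq> G - {i, j}" "card L = m"
        by (meson obtain_subset_with_card_n)
      then show ?thesis using G by (intro exI[of _ L]) (auto simp: G_def)
    qed
    then have "\<forall>e\<in>square_edges v i j. \<exists>L. L \<subseteq> {..<n} - {i, j} \<and> card L = m \<and> (\<forall>l\<in>L. \<omega> (cube_face n {snd e, l} (fst e)))"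
      by auto
    then obtain L0 where L0: "\<And>e. e \<in> square_edges v i j \<Longrightarrow> L0 e \<subseteq> {..<n} - {i, j} \<and> card (L0 e) = m \<and>
        (\<forall>l\<in>L0 e. \<omega> (cube_face n {snd e, l} (fst e)))"
      by metis
    define L where "L = restrict L0 (square_edges v i j)"
    have L: "L e \<subseteq> {..<n} - {i, j} \<and> card (L e) = m \<and> (\<forall>l\<in>L e. \<omega> (cube_face n {snd e, l} (fst e)))"
      if "e \<in> square_edges v i j" for e using L0[OF that] that by (simp add: L_def)
    have "L \<in> choices v i j" unfolding choices_def L_def using L0 by auto
    then have "\<omega> \<notin> uncapped v i j L" using good(2) v ij unfolding bad_square_def by blast
    then obtain k where k: "k < n" "k \<notin> {i, j}" "k \<notin> \<Union>(L ` square_edges v i j)" "\<omega> \<in> capped n v i j L k"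
      by (auto simp: uncapped_def)
    show ?thesis
    proof (rule capped_commuting[where K = K and \<omega> = \<omega> and n = n and L = L and k = k])
      show "L (a, d) \<subseteq> {..<n} - {i, j}" if "(a, d) \<in> square_edges v i j" for a d
        using L[OF that] by simp
      show "\<omega> (cube_face n {d, l} a)" if "(a, d) \<in> square_edges v i j" "l \<in> L (a, d)" for a d l
        using L[OF that(1)] that(2) by simp
      show "k \<notin> L (a, d)" if "(a, d) \<in> square_edges v i j" for a d
        using k(3) that by blast
    qed (use v ij k edges in \<open>auto simp: K_def\<close>)
  qed
  interpret commuting_cubical_complex n K
  proof
    show "\<exists>F v. v \<in> cube_vertices n \<and> \<sigma> = cube_face n F v" if "\<sigma> \<in> K" for \<sigma>
      using that unfolding K_def cube_faces_def by blast
    show "cube_vertices n \<subseteq> \<Union>K"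
    proof
      fix v assume v: "v \<in> cube_vertices n"
      have "card ({} :: nat set) = 0" "({} :: nat set) \<subseteq> {..<n}" by auto
      then have "cube_face n {} v \<in> cube_faces n 0" unfolding cube_faces_def using v by blast
      then have "cube_face n {} v \<in> K" by (simp add: K_def)
      then show "v \<in> \<Union>K" using vertex_in_face[OF v] by blast
    qed
  qed (use edges square in auto)
  show ?thesis using x by (rule trivial_fundamental_group)
qed

lemma prob_trivial_ge:
  assumes "q \<le> 1" "m \<le> n" "n > 0"
  shows "1 - 2 ^ n * real n ^ (m + 1) * (1 - p) ^ (n - (m + 1))
      - 2 ^ n * real n ^ (4 * m + 2) * q ^ (n - (4 * m + 2))
    \<le> measure_pmf.prob (random_cubical_2_complex n p)
        {K. \<forall>x\<in>\<Union>K. trivial_group (fundamental_group (\<Union>K) x)}"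
proof -
  let ?K = "\<lambda>\<omega>. cube_faces n 0 \<union> cube_faces n 1 \<union> {\<sigma> \<in> cube_faces n 2. \<omega> \<sigma>}"
  let ?G = "{K. \<forall>x\<in>\<Union>K. trivial_group (fundamental_group (\<Union>K) x)}"
  have "measure_pmf.prob \<Omega> (bad_edge \<union> bad_square) \<le> measure_pmf.prob \<Omega> bad_edge + measure_pmf.prob \<Omega> bad_square"
    by (rule measure_Un_le) auto
  moreover have "measure_pmf.prob \<Omega> (- (bad_edge \<union> bad_square)) = 1 - measure_pmf.prob \<Omega> (bad_edge \<union> bad_square)"
    using measure_pmf.prob_compl[of "bad_edge \<union> bad_square" \<Omega>] by (simp add: Compl_eq_Diff_UNIV)
  moreover have "measure_pmf.prob \<Omega> (- (bad_edge \<union> bad_square)) \<le> measure_pmf.prob \<Omega> (?K -` ?G)"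
  proof (rule measure_pmf.finite_measure_mono)
    show "- (bad_edge \<union> bad_square) \<subseteq> ?K -` ?G"
    proof
      fix \<omega> assume "\<omega> \<in> - (bad_edge \<union> bad_square)"
      then have "\<omega> \<notin> bad_edge" "\<omega> \<notin> bad_square" by auto
      from good_trivial[OF this assms(2)] show "\<omega> \<in> ?K -` ?G"
        unfolding vimage_eq mem_Collect_eq by blast
    qed
  qed simp
  moreover have "measure_pmf.prob (random_cubical_2_complex n p) ?G = measure_pmf.prob \<Omega> (?K -` ?G)"
    unfolding random_cubical_2_complex_def by (rule measure_map_pmf)
  ultimately show ?thesis using prob_bad_edge prob_bad_square[OF assms(1,3)] by linarith
qed

end

theorem theorem1p2:
  fixes p :: real
  assumes "1/2 < p" and "p \<le> 1"
  shows "(\<lambda>n. measure_pmf.prob (random_cubical_2_complex n p)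
            {K. \<forall>x\<in>\<Union>K. trivial_group (fundamental_group (\<Union>K) x)}) \<longlonglongrightarrow> 1"
proof -
  have p4: "0 < p ^ 4" "p ^ 4 \<le> 1" using assms by (auto intro: power_le_one)
  have "(\<lambda>m. (1 - p) + 4 * (1 - p ^ 4) ^ m) \<longlonglongrightarrow> (1 - p) + 4 * 0"
    using p4 by (intro tendsto_intros LIMSEQ_realpow_zero) auto
  then have "\<forall>\<^sub>F m in sequentially. (1 - p) + 4 * (1 - p ^ 4) ^ m < 1/2"
    by (rule order_tendstoD) (use assms in simp)
  \<comment> \<open>since \<open>1 - p < 1/2\<close>, a constant number \<open>m\<close> of auxiliary directions makes the failure probability of a direction less than \<open>1/2\<close>\<close>
  then obtain m where m: "(1 - p) + 4 * (1 - p ^ 4) ^ m < 1/2"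
    by (auto simp: eventually_sequentially)
  define r where "r = (1 - p) + 4 * (1 - p ^ 4) ^ m"
  have r: "0 \<le> r" "r < 1/2" using m p4 assms by (auto simp: r_def)
  let ?P = "\<lambda>n. measure_pmf.prob (random_cubical_2_complex n p)
            {K. \<forall>x\<in>\<Union>K. trivial_group (fundamental_group (\<Union>K) x)}"
  let ?l = "\<lambda>n. 1 - 2 ^ n * real n ^ (m + 1) * (1 - p) ^ (n - (m + 1))
      - 2 ^ n * real n ^ (4 * m + 2) * r ^ (n - (4 * m + 2))"
  have "?l \<longlonglongrightarrow> 1 - 0 - 0"
    by (intro tendsto_diff tendsto_const power_poly_tendsto_0) (use assms r in auto)
  then have l: "?l \<longlonglongrightarrow> 1" by simp
  show ?thesis
  proof (rule tendsto_sandwich[OF _ _ l tendsto_const])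
    show "\<forall>\<^sub>F n in sequentially. ?l n \<le> ?P n"
      using eventually_ge_at_top[of "Suc m"]
    proof eventually_elim
      case (elim n)
      interpret random_squares n m p by unfold_locales (use assms in auto)
      have "q = r" by (simp add: q_def r_def)
      then show ?case using prob_trivial_ge elim r by simp
    qed
  qed simp
qed

end
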